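(* Let $c_0>0$ be a fixed universal constant that is admissible in the sense of the context. Fix $p\in(0,1)$. There are constants $C=C(p)<\infty$ and $n_*=n_*(p)<\infty$ such that, whenever an integer $n\ge n_*$ satisfies $$\mathbb P_p^{\mathrm L}\bigl(\mathrm{Cross}(100n,n)\bigr)\ge c_0,$$ then, for every $M\ge Cn^{10}$, $$\mathbb P_p^{\mathrm L}\bigl(B_n^{(M)}\bigr)\ge 1-C\exp\left\{-\frac{M}{Cn^{10}}\right\}.$$ Here $\mathbb P_p^{\mathrm L}$ is the Lorentz mirror law (on $\mathbb Z^2$ for $\mathrm{Cross}$, on the cylinder $\mathcal C_n$ for $B_n^{(M)}$).
   Context: Lattices: $\mathbb Z^2$ with nearest-neighbor edges, and for an integer $n\ge1$ the cylinder $\mathcal C_n=\mathbb Z\times(\mathbb Z/2n\mathbb Z)$ (quotient of $\mathbb Z^2$ by translation by $(0,2n)$; its edges are the images of the edges of $\mathbb Z^2$). Mirrors and trajectories: each vertex has four incident half-edges $N,E,S,W$ (pointing in directions $(0,1),(1,0),(0,-1),(-1,0)$). A one-site state is one of: no mirror, pairing $(N,S)(E,W)$; a north-west (NW) mirror (a diagonal segment along the NW--SE direction), pairing $(N,E)(S,W)$; a north-east (NE) mirror (along the NE--SW direction), pairing $(N,W)(S,E)$. A ray arriving at a vertex along a half-edge leaves along the half-edge paired with it. A directed edge is an ordered pair $(u,v)$ of nearest neighbors along an edge; together with the environment (a state at each vertex) it determines a trajectory, i.e. the sequence of directed edges starting with $(u,v)$ and following this rule at each vertex; $u$ is its initial vertex.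 A trajectory segment is a finite sequence of consecutive directed edges $e_k=(v_{k-1},v_k)$ following the rule at each intermediate vertex. A trajectory remains in a set if all its vertices lie in it. Lorentz mirror law $\mathbb P_p^{\mathrm L}$ (on $\mathbb Z^2$ or $\mathcal C_n$): independently at each vertex, no mirror with probability $1-p$, and a NW or NE mirror with probability $p/2$ each. Manhattan law $\mathbb P_p^{\mathrm M}$ (on $\mathbb Z^2$ or $\mathcal C_n$; used here only in the definition of admissible): independently at each vertex $(x,y)$, a mirror with probability $p$ and no mirror with probability $1-p$; a mirror at $(x,y)$ is NW if $x-y$ is even and NE otherwise. Crossing event (on $\mathbb Z^2$): for integers $m,h\ge1$ let $R_{m,h}=\{1,\dots,m\}\times\{1,\dots,h\}$. For $1\le i,j\le m$, $\mathrm{Cross}_{i,j}(m,h)$ is the event that there is a trajectory segment which enters $R_{m,h}$ through the directed edge $((i,0),(i,1))$, exits through $((j,h),(j,h+1))$, and has all intermediate vertices in $R_{m,h}$. $\mathrm{Cross}(m,h)=\bigcup_{1\le i,j\le m}\mathrm{Cross}_{i,j}(m,h)$. Localization event (on $\mathcal C_n$): for $M\ge1$, $B_n^{(M)}$ is the event that every trajectory whose initial vertex lies in $\{0\}\times(\mathbb Z/2n\mathbb Z)$ remains in $[-M,M]\times(\mathbb Z/2n\mathbb Z)$. Admissible constant: $c_0>0$ is a universal constant (independent of $p$, $n$, and the model), fixed once and for all and chosen small enough that the following holds: there are universal constants $c',C'>0$ such that for each of the two models, every $p\in(0,1)$ and every integer $n_0>100$ with $\mathbb P_p(\mathrm{Cross}(100n_0,n_0))\le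 c_0$, one has, for all $m\ge C'n_0$, that with probability at least $1-\exp\{-c'm/n_0\}$ every trajectory on $\mathbb Z^2$ with initial vertex in $[-1,1]^2$ remains in $[-m,m]^2$. *)

theory Defs
  imports "HOL-Probability.Probability"
begin

type_synonym vertex = "int \<times> int"

datatype dir = North | East | South | West

datatype mirror = NoMirror | NW | NE

type_synonym env = "vertex \<Rightarrow> mirror"

fun dir_vec :: "dir \<Rightarrow> int \<times> int" where
  "dir_vec North = (0, 1)"
| "dir_vec East = (1, 0)"
| "dir_vec South = (0, -1)"
| "dir_vec West = (-1, 0)"

fun opposite :: "dir \<Rightarrow> dir" where
  "opposite North = South"
| "opposite East = West"
| "opposite South = North"
| "opposite West = East"

text \<open>The half-edge paired with a given half-edge in a one-site state. An NW mirror is a segment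
  along the NW--SE diagonal, an NE mirror one along the NE--SW diagonal.\<close>

fun paired :: "mirror \<Rightarrow> dir \<Rightarrow> dir" where
  "paired NoMirror North = South"
| "paired NoMirror South = North"
| "paired NoMirror East = West"
| "paired NoMirror West = East"
| "paired NW North = East"
| "paired NW East = North"
| "paired NW South = West"
| "paired NW West = South"
| "paired NE North = West"
| "paired NE West = North"
| "paired NE South = East"
| "paired NE East = South"

text \<open>A lattice is given by the function sending a vertex and a direction to the corresponding
  neighbour. The vertices of the cylinder of circumference \<open>2n\<close> are represented by the pairs
  \<open>(x, y)\<close> with \<open>0 \<le> y < 2n\<close>.\<close>

type_synonym lattice = "vertex \<Rightarrow> dir \<Rightarrow> vertex"

definition plane :: lattice where
  "plane v d = (fst v + fst (dir_vec d), snd v + snd (dir_vec d))"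

definition cylinder :: "nat \<Rightarrow> lattice" where
  "cylinder n v d = (fst v + fst (dir_vec d), (snd v + snd (dir_vec d)) mod (2 * int n))"

definition cylinder_vertices :: "nat \<Rightarrow> vertex set" where
  "cylinder_vertices n = UNIV \<times> {0..<2 * int n}"

text \<open>A directed edge is represented by its initial vertex and its direction. This keeps the
  two parallel edges between \<open>(x, 0)\<close> and \<open>(x, 1)\<close> apart when \<open>n = 1\<close>. An edge with direction
  \<open>d\<close> arrives at its end vertex along the half-edge opposite to \<open>d\<close>.\<close>

type_synonym dedge = "vertex \<times> dir"

definition next_edge :: "lattice \<Rightarrow> env \<Rightarrow> dedge \<Rightarrow> dedge" where
  "next_edge L \<omega> e =
     (let v = L (fst e) (snd e) in (v, paired (\<omega> v) (opposite (snd e))))"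

definition trajectory :: "lattice \<Rightarrow> env \<Rightarrow> dedge \<Rightarrow> nat \<Rightarrow> dedge" where
  "trajectory L \<omega> e k = (next_edge L \<omega> ^^ k) e"

definition trajectory_segment :: "lattice \<Rightarrow> env \<Rightarrow> dedge list \<Rightarrow> bool" where
  "trajectory_segment L \<omega> es \<longleftrightarrow>
     es \<noteq> [] \<and> (\<forall>k. Suc k < length es \<longrightarrow> es ! Suc k = next_edge L \<omega> (es ! k))"

text \<open>The vertices of a trajectory are the initial vertices of its edges, since the end vertex
  of an edge is the initial vertex of the following one.\<close>

definition remains_in :: "lattice \<Rightarrow> env \<Rightarrow> dedge \<Rightarrow> vertex set \<Rightarrow> bool" where
  "remains_in L \<omega> e A \<longleftrightarrow> (\<forall>k. fst (trajectory L \<omega> e k) \<in> A)"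

definition lorentz_site :: "real \<Rightarrow> vertex \<Rightarrow> mirror pmf" where
  "lorentz_site p v =
     bind_pmf (bernoulli_pmf p) (\<lambda>b.
       if b then map_pmf (\<lambda>b'. if b' then NW else NE) (bernoulli_pmf (1/2))
       else return_pmf NoMirror)"

definition manhattan_site :: "real \<Rightarrow> vertex \<Rightarrow> mirror pmf" where
  "manhattan_site p v =
     map_pmf (\<lambda>b. if b then (if even (fst v - snd v) then NW else NE) else NoMirror)
       (bernoulli_pmf p)"

definition lorentz_plane :: "real \<Rightarrow> env measure" where
  "lorentz_plane p = (\<Pi>\<^sub>M v\<in>UNIV. measure_pmf (lorentz_site p v))"

definition manhattan_plane :: "real \<Rightarrow> env measure" where
  "manhattan_plane p = (\<Pi>\<^sub>M v\<in>UNIV. measure_pmf (manhattan_site p v))"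

definition lorentz_cylinder :: "nat \<Rightarrow> real \<Rightarrow> env measure" where
  "lorentz_cylinder n p = (\<Pi>\<^sub>M v\<in>cylinder_vertices n. measure_pmf (lorentz_site p v))"

definition rectangle :: "nat \<Rightarrow> nat \<Rightarrow> vertex set" where
  "rectangle m h = {1..int m} \<times> {1..int h}"

text \<open>The intermediate vertices of a segment are the initial vertices of all its edges but the
  first.\<close>

definition cross_at :: "nat \<Rightarrow> nat \<Rightarrow> int \<Rightarrow> int \<Rightarrow> env \<Rightarrow> bool" where
  "cross_at m h i j \<omega> \<longleftrightarrow>
     (\<exists>es. trajectory_segment plane \<omega> es \<and>
           hd es = ((i, 0), North) \<and> last es = ((j, int h), North) \<and>
           (\<forall>k. 0 < k \<and> k < length es \<longrightarrow> fst (es ! k) \<in> rectangle m h))"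

definition cross :: "nat \<Rightarrow> nat \<Rightarrow> env \<Rightarrow> bool" where
  "cross m h \<omega> \<longleftrightarrow> (\<exists>i\<in>{1..int m}. \<exists>j\<in>{1..int m}. cross_at m h i j \<omega>)"

definition localized :: "nat \<Rightarrow> real \<Rightarrow> env \<Rightarrow> bool" where
  "localized n M \<omega> \<longleftrightarrow>
     (\<forall>u d. u \<in> {0} \<times> {0..<2 * int n} \<longrightarrow>
        remains_in (cylinder n) \<omega> (u, d)
          {v \<in> cylinder_vertices n. \<bar>real_of_int (fst v)\<bar> \<le> M})"

definition confined :: "real \<Rightarrow> env \<Rightarrow> bool" where
  "confined m \<omega> \<longleftrightarrow>
     (\<forall>u d. u \<in> {-1..1} \<times> {-1..1} \<longrightarrow>
        remains_in plane \<omega> (u, d)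
          {v. \<bar>real_of_int (fst v)\<bar> \<le> m \<and> \<bar>real_of_int (snd v)\<bar> \<le> m})"

definition admissible :: "real \<Rightarrow> bool" where
  "admissible c0 \<longleftrightarrow> c0 > 0 \<and>
     (\<exists>c'>0. \<exists>C'>0. \<forall>law\<in>{lorentz_plane, manhattan_plane}. \<forall>p\<in>{0<..<1}. \<forall>n0::nat.
        n0 > 100 \<longrightarrow> \<P>(\<omega> in law p. cross (100 * n0) n0 \<omega>) \<le> c0 \<longrightarrow>
        (\<forall>m::real. m \<ge> C' * real n0 \<longrightarrow>
           \<P>(\<omega> in law p. confined m \<omega>) \<ge> 1 - exp (- c' * m / real n0)))"

end

theory Submission
  imports Defs
begin

text \<open>By pigeonhole some fixed pair \<open>(i, j)\<close> has crossing probability at least \<open>c0 / (100n)\<^sup>2\<close>. In a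
  fresh stretch of \<open>100n\<close> columns of the cylinder, such a crossing in one half and a reflected copy
  of such a crossing in the other half share both end edges and hence close up to a loop that winds
  once around the cylinder; this has probability of order \<open>n\<^sup>-\<^sup>4\<close>. Every trajectory that passes the
  stretch from left to right meets the loop. Since the circumference is even, the number of passing
  trajectories is even, so unless it is zero there are two of them, and changing the mirrors at two
  vertices of the loop makes one of them turn back. Choosing these two vertices costs another factor
  of order \<open>n\<^sup>-\<^sup>4\<close>. Thus in each stretch the number of passing trajectories, initially at most \<open>2n\<close>,
  decreases with conditional probability of order \<open>n\<^sup>-\<^sup>8\<close>, and the expectation of \<open>2\<close> to the power of
  this number, restricted to the event that it is nonzero, decays exponentially. Order \<open>n\<^sup>9\<close>
  stretches of length \<open>100n\<close> account for the exponent \<open>10\<close>.\<close>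

section \<open>Trajectories\<close>

text \<open>Parity is the real obstacle. The number of passing trajectories always has the parity of
  the circumference, whatever the mirrors, so on an odd cylinder one of them would survive every
  modification. A passing trajectory is followed only from its edge into column 1 and only while it
  stays in columns \<ge> 1. Its fate up to column w is therefore a function of columns 1 to w, and
  the next stretch is still independent of it; this is what lets the decrease be iterated. That the
  loop must be met rests on a signed count instead of a Jordan curve argument: the net number of
  upward crossings of a leftward ray by the loop is 0 to the left of the loop, 1 to its right, and
  changes only on the loop. Each changed vertex costs n^2 because its position is unknown and a
  union bound over the 200 n^2 vertices of the stretch is paid. The initial weight 2^(2n) then takes
  n * n^8 stretches to be absorbed, and their length contributes the tenth factor n. The left half
  of the cylinder is treated by reflection.\<close>

definition rev_edge :: "lattice \<Rightarrow> dedge \<Rightarrow> dedge" where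
  "rev_edge L e = (L (fst e) (snd e), opposite (snd e))"

lemma opposite_opposite [simp]: "opposite (opposite d) = d"
  by (cases d) auto

lemma opposite_eq_iff [simp]: "opposite d = opposite d' \<longleftrightarrow> d = d'"
  by (cases d; cases d') auto

lemma paired_paired [simp]: "paired m (paired m d) = d"
  by (cases m; cases d) auto

lemma paired_neq [simp]: "paired m d \<noteq> d"
  by (cases m; cases d) auto

lemma opposite_neq [simp]: "opposite d \<noteq> d"
  by (cases d) auto

lemma ex_paired:
  assumes "d \<noteq> d'" shows "\<exists>m. paired m d = d'"
proof -
  have "paired NoMirror d = d' \<or> paired NW d = d' \<or> paired NE d = d'"
    using assms by (cases d; cases d') auto
  then show ?thesis by blast
qed

lemma next_edge_Pair:
  "next_edge L \<omega> (u, d) = (L u d, paired (\<omega> (L u d)) (opposite d))"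
  by (simp add: next_edge_def Let_def)

lemma fst_next_edge: "fst (next_edge L \<omega> e) = L (fst e) (snd e)"
  by (simp add: next_edge_def Let_def)

lemma trajectory_0 [simp]: "trajectory L \<omega> e 0 = e"
  by (simp add: trajectory_def)

lemma trajectory_Suc: "trajectory L \<omega> e (Suc k) = next_edge L \<omega> (trajectory L \<omega> e k)"
  by (simp add: trajectory_def)

lemma trajectory_add:
  "trajectory L \<omega> e (j + k) = trajectory L \<omega> (trajectory L \<omega> e j) k"
  by (induction k) (simp_all add: trajectory_Suc)

text \<open>Step \<open>k\<close> reads the states met at times 1 to \<open>k\<close>; the state at
  the initial vertex is read only if the trajectory comes back to it, whence
  \<open>0 < j\<close>.\<close>

lemma trajectory_cong:
  assumes "\<And>j. 0 < j \<Longrightarrow> j \<le> k \<Longrightarrow> \<omega>' (fst (trajectory L \<omega> e j)) = \<omega> (fst (trajectory L \<omega> e j))"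
  shows "trajectory L \<omega>' e k = trajectory L \<omega> e k"
  using assms
proof (induction k)
  case (Suc k)
  then have IH: "trajectory L \<omega>' e k = trajectory L \<omega> e k" by simp
  show ?case
    using Suc.prems[of "Suc k"] IH
    by (cases "trajectory L \<omega> e k") (simp add: trajectory_Suc next_edge_Pair)
qed simp

text \<open>Serves three lattice maps: wrapping the plane around the cylinder, the same with a
  vertical reflection, and the left-right reflection. The map \<open>s\<close> is there because a
  reflection exchanges the two mirror types.\<close>

lemma trajectory_hom:
  fixes \<phi> :: "vertex \<Rightarrow> vertex" and \<delta> :: "dir \<Rightarrow> dir"
  assumes "\<And>v d. L' (\<phi> v) (\<delta> d) = \<phi> (L v d)"
    and "\<And>d. opposite (\<delta> d) = \<delta> (opposite d)"
    and "\<And>m d. paired m (\<delta> d) = \<delta> (paired (s m) d)"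
  shows "trajectory L' \<omega> (map_prod \<phi> \<delta> e) k = map_prod \<phi> \<delta> (trajectory L (s \<circ> \<omega> \<circ> \<phi>) e k)"
proof (induction k)
  case (Suc k)
  obtain v d where vd: "trajectory L (s \<circ> \<omega> \<circ> \<phi>) e k = (v, d)" by fastforce
  show ?case
    unfolding trajectory_Suc Suc vd map_prod_simp next_edge_Pair assms by simp
qed simp

text \<open>Plays the part of measurability with respect to the sites in \<open>A\<close>. For
  finite \<open>A\<close> it transfers probabilities between laws, and over disjoint sets it yields
  independence.\<close>

definition depends_on :: "vertex set \<Rightarrow> (env \<Rightarrow> bool) \<Rightarrow> bool" where
  "depends_on A E \<longleftrightarrow> (\<forall>\<omega> \<omega>'. (\<forall>v\<in>A. \<omega> v = \<omega>' v) \<longrightarrow> E \<omega> = E \<omega>')"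

lemma depends_onI:
  assumes "\<And>\<omega> \<omega>'. (\<And>v. v \<in> A \<Longrightarrow> \<omega> v = \<omega>' v) \<Longrightarrow> E \<omega> \<Longrightarrow> E \<omega>'"
  shows "depends_on A E"
  unfolding depends_on_def using assms by metis

lemma depends_onD:
  "depends_on A E \<Longrightarrow> (\<And>v. v \<in> A \<Longrightarrow> \<omega> v = \<omega>' v) \<Longrightarrow> E \<omega> \<longleftrightarrow> E \<omega>'"
  unfolding depends_on_def by blast

lemma depends_on_mono: "depends_on A E \<Longrightarrow> A \<subseteq> B \<Longrightarrow> depends_on B E"
  unfolding depends_on_def by blast

subsection \<open>Crossings of a rectangle\<close>

lemma finite_rectangle [simp]: "finite (rectangle m h)"
  by (simp add: rectangle_def)

text \<open>The rule is deterministic, so a segment is a prefix of the trajectory of its first edge,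
  and the quantifier over lists becomes one over times.\<close>

lemma cross_at_alt:
  assumes "h \<ge> 1"
  shows "cross_at m h i j \<omega> \<longleftrightarrow>
    (\<exists>k. trajectory plane \<omega> ((i, 0), North) k = ((j, int h), North) \<and>
         (\<forall>l. 0 < l \<and> l \<le> k \<longrightarrow> fst (trajectory plane \<omega> ((i, 0), North) l) \<in> rectangle m h))"
    (is "?L \<longleftrightarrow> ?R")
proof
  assume ?L
  then obtain es where es: "es \<noteq> []"
      "\<And>k. Suc k < length es \<Longrightarrow> es ! Suc k = next_edge plane \<omega> (es ! k)"
      "hd es = ((i, 0), North)" "last es = ((j, int h), North)"
      "\<And>k. 0 < k \<Longrightarrow> k < length es \<Longrightarrow> fst (es ! k) \<in> rectangle m h"
    unfolding cross_at_def trajectory_segment_def by blast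
  have nth: "es ! k = trajectory plane \<omega> ((i, 0), North) k" if "k < length es" for k
    using that
  proof (induction k)
    case 0
    then show ?case using es(1,3) by (simp add: hd_conv_nth)
  next
    case (Suc k)
    then show ?case using es(2)[of k] by (simp add: trajectory_Suc)
  qed
  have lt: "k < length es" if "k \<le> length es - 1" for k
    using that es(1) by (cases es) auto
  show ?R
  proof (intro exI[of _ "length es - 1"] conjI allI impI)
    show "trajectory plane \<omega> ((i, 0), North) (length es - 1) = ((j, int h), North)"
      using es(1,4) nth[OF lt] by (simp add: last_conv_nth)
    show "fst (trajectory plane \<omega> ((i, 0), North) l) \<in> rectangle m h"
      if "0 < l \<and> l \<le> length es - 1" for l
      using that es(5)[of l] nth[of l] lt[of l] by simp
  qed
next
  assume ?R
  then obtain k where k: "trajectory plane \<omega> ((i, 0), North) k = ((j, int h), North)"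
      "\<And>l. 0 < l \<Longrightarrow> l \<le> k \<Longrightarrow> fst (trajectory plane \<omega> ((i, 0), North) l) \<in> rectangle m h"
    by blast
  define es where "es = map (trajectory plane \<omega> ((i, 0), North)) [0..<Suc k]"
  have nth: "es ! l = trajectory plane \<omega> ((i, 0), North) l" if "l < Suc k" for l
    using that unfolding es_def by (simp del: upt_Suc)
  have len: "length es = Suc k" by (simp add: es_def)
  show ?L
    unfolding cross_at_def trajectory_segment_def
  proof (intro exI[of _ es] conjI allI impI)
    show ne: "es \<noteq> []" using len by auto
    show "es ! Suc l = next_edge plane \<omega> (es ! l)" if "Suc l < length es" for l
      using that by (simp add: nth len trajectory_Suc)
    show "hd es = ((i, 0), North)" using ne by (simp add: hd_conv_nth nth)
    show "last es = ((j, int h), North)" using ne by (simp add: last_conv_nth nth len k)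
    show "fst (es ! l) \<in> rectangle m h" if "0 < l \<and> l < length es" for l
      using that by (simp add: nth len k)
  qed
qed

lemma depends_on_cross_at:
  assumes "h \<ge> 1" shows "depends_on (rectangle m h) (cross_at m h i j)"
proof (rule depends_onI)
  fix \<omega> \<omega>' :: env
  assume eq: "\<And>v. v \<in> rectangle m h \<Longrightarrow> \<omega> v = \<omega>' v" and "cross_at m h i j \<omega>"
  then obtain k where k: "trajectory plane \<omega> ((i, 0), North) k = ((j, int h), North)"
      "\<And>l. 0 < l \<Longrightarrow> l \<le> k \<Longrightarrow> fst (trajectory plane \<omega> ((i, 0), North) l) \<in> rectangle m h"
    unfolding cross_at_alt[OF assms] by blast
  have "trajectory plane \<omega>' ((i, 0), North) l = trajectory plane \<omega> ((i, 0), North) l" if "l \<le> k" for l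
    by (rule trajectory_cong) (use eq k(2) that in auto)
  then show "cross_at m h i j \<omega>'"
    unfolding cross_at_alt[OF assms] using k by (metis order_refl)
qed

lemma depends_on_cross:
  assumes "h \<ge> 1" shows "depends_on (rectangle m h) (cross m h)"
  using depends_on_cross_at[OF assms] unfolding depends_on_def cross_def by blast

section \<open>The cylinder\<close>

lemma cylinder_in_vertices [simp]: "n \<ge> 1 \<Longrightarrow> cylinder n v d \<in> cylinder_vertices n"
  by (simp add: cylinder_def cylinder_vertices_def)

section \<open>Time reversal\<close>

lemma cylinder_opposite:
  assumes "v \<in> cylinder_vertices n"
  shows "cylinder n (cylinder n v d) (opposite d) = v"
proof -
  have "((snd v + c) mod (2 * int n) - c) mod (2 * int n) = snd v" for c
    using assms by (simp add: mod_diff_left_eq cylinder_vertices_def mem_Times_iff)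
  from this[of 1] this[of "-1"] this[of 0] show ?thesis
    using assms by (cases d) (auto simp: cylinder_def cylinder_vertices_def)
qed

lemma rev_edge_rev_edge:
  "fst e \<in> cylinder_vertices n \<Longrightarrow> rev_edge (cylinder n) (rev_edge (cylinder n) e) = e"
  by (simp add: rev_edge_def cylinder_opposite)

text \<open>\<open>paired\<close> is an involution, so the state that produced a step also undoes it
  for the reversed edge.\<close>

lemma next_edge_rev_edge:
  assumes "n \<ge> 1"
  shows "next_edge (cylinder n) \<omega> (rev_edge (cylinder n) (next_edge (cylinder n) \<omega> e)) =
         rev_edge (cylinder n) e"
  using assms by (cases e) (simp add: next_edge_Pair rev_edge_def cylinder_opposite)

lemma trajectory_rev_edge:
  assumes "n \<ge> 1" and "j \<le> k"
  shows "trajectory (cylinder n) \<omega> (rev_edge (cylinder n) (trajectory (cylinder n) \<omega> e k)) j =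
         rev_edge (cylinder n) (trajectory (cylinder n) \<omega> e (k - j))"
  using assms(2)
proof (induction j)
  case (Suc j)
  have "k - j = Suc (k - Suc j)" using Suc.prems by simp
  then show ?case
    using Suc next_edge_rev_edge[OF assms(1)] by (simp add: trajectory_Suc)
qed simp

lemma trajectory_in_vertices:
  assumes "n \<ge> 1" "fst e \<in> cylinder_vertices n"
  shows "fst (trajectory (cylinder n) \<omega> e k) \<in> cylinder_vertices n"
  using assms by (cases k) (simp_all add: trajectory_Suc fst_next_edge)

text \<open>The past of an edge is as determined as its future: reverse the common edge and run
  \<open>k\<close> steps.\<close>

lemma trajectory_backtrack:
  assumes n: "n \<ge> 1" and e: "fst e \<in> cylinder_vertices n" "fst e' \<in> cylinder_vertices n"
    and eq: "trajectory (cylinder n) \<omega> e (a + k) = trajectory (cylinder n) \<omega> e' k"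
  shows "trajectory (cylinder n) \<omega> e a = e'"
proof -
  have "rev_edge (cylinder n) (trajectory (cylinder n) \<omega> e a) = rev_edge (cylinder n) e'"
    using trajectory_rev_edge[OF n, of k "a + k" \<omega> e] trajectory_rev_edge[OF n, of k k \<omega> e'] eq
    by simp
  then show ?thesis
    using rev_edge_rev_edge trajectory_in_vertices[OF n e(1)] e(2) by metis
qed

text \<open>Such a trajectory would be a palindrome in time. At its midpoint, for even
  \<open>k\<close> an edge would equal its own reversal, and for odd \<open>k\<close> a vertex would
  pair a half-edge with itself.\<close>

lemma trajectory_neq_rev_edge:
  assumes n: "n \<ge> 1" and e: "fst e \<in> cylinder_vertices n"
  shows "trajectory (cylinder n) \<omega> e k \<noteq> rev_edge (cylinder n) e"
proof
  let ?t = "trajectory (cylinder n) \<omega> e"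
  assume k: "?t k = rev_edge (cylinder n) e"
  have palindrome: "?t j = rev_edge (cylinder n) (?t (k - j))" if "j \<le> k" for j
    using trajectory_rev_edge[OF n that, of \<omega> e] k by (simp add: rev_edge_rev_edge[OF e])
  define j where "j = k div 2"
  consider "k - j = j" "j \<le> k" | "k - j = Suc j" "j \<le> k"
    unfolding j_def by linarith
  then show False
  proof cases
    case 1
    then show False
      using arg_cong[OF palindrome[of j], of snd] opposite_neq by (metis rev_edge_def snd_conv)
  next
    case 2
    have "snd (?t j) = opposite (snd (?t (Suc j)))"
      using arg_cong[OF palindrome[of j], of snd] 2 by (simp add: rev_edge_def)
    then show False
      by (cases "?t j") (simp add: trajectory_Suc next_edge_Pair, metis opposite_opposite paired_neq)
  qed
qed


section \<open>Passing trajectories\<close>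

definition entry :: "int \<Rightarrow> dedge" where
  "entry y = ((0, y), East)"

definition col :: "dedge \<Rightarrow> int" where
  "col e = fst (fst e)"

text \<open>Only the first excursion to the right of column 0 counts. For \<open>0 \<le> w\<close>
  this makes the event a function of columns 1 to \<open>w\<close>, whatever the environment
  elsewhere.\<close>

definition passes :: "nat \<Rightarrow> int \<Rightarrow> env \<Rightarrow> int \<Rightarrow> bool" where
  "passes n w \<omega> y \<longleftrightarrow> (\<exists>k. w < col (trajectory (cylinder n) \<omega> (entry y) k) \<and>
     (\<forall>j. 0 < j \<and> j \<le> k \<longrightarrow> 1 \<le> col (trajectory (cylinder n) \<omega> (entry y) j)))"

definition passing :: "nat \<Rightarrow> int \<Rightarrow> env \<Rightarrow> int set" where
  "passing n w \<omega> = {y \<in> {0..<2 * int n}. passes n w \<omega> y}"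

text \<open>Half-open in the columns, so that consecutive stretches fit together without
  overlap.\<close>

definition block :: "nat \<Rightarrow> int \<Rightarrow> int \<Rightarrow> vertex set" where
  "block n w w' = {w<..w'} \<times> {0..<2 * int n}"

lemma finite_block [simp]: "finite (block n w w')"
  by (simp add: block_def)

lemma passing_subset: "passing n w \<omega> \<subseteq> {0..<2 * int n}"
  by (auto simp: passing_def)

lemma finite_passing [simp]: "finite (passing n w \<omega>)"
  using passing_subset by (rule finite_subset) simp

lemma card_passing_le: "card (passing n w \<omega>) \<le> 2 * n"
  using card_mono[OF _ passing_subset[of n w \<omega>]] by simp

lemma passing_antimono: "w \<le> w' \<Longrightarrow> passing n w' \<omega> \<subseteq> passing n w \<omega>"
  unfolding passing_def passes_def by (blast intro: le_less_trans)

lemma entry_in_vertices: "y \<in> {0..<2 * int n} \<Longrightarrow> fst (entry y) \<in> cylinder_vertices n"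
  by (simp add: entry_def cylinder_vertices_def)

lemma col_entry [simp]: "col (entry y) = 0"
  by (simp add: entry_def col_def)

lemma col_next_edge: "col (next_edge (cylinder n) \<omega> e) = col e + fst (dir_vec (snd e))"
  by (simp add: col_def fst_next_edge cylinder_def)

lemma passes_minimal:
  assumes "passes n w \<omega> y" "0 \<le> w"
  obtains k where "0 < k" "w < col (trajectory (cylinder n) \<omega> (entry y) k)"
    "\<And>j. 0 < j \<Longrightarrow> j \<le> k \<Longrightarrow> 1 \<le> col (trajectory (cylinder n) \<omega> (entry y) j)"
    "\<And>j. j < k \<Longrightarrow> col (trajectory (cylinder n) \<omega> (entry y) j) \<le> w"
proof -
  let ?t = "\<lambda>k. col (trajectory (cylinder n) \<omega> (entry y) k)"
  obtain k0 where k0: "w < ?t k0" "\<And>j. 0 < j \<Longrightarrow> j \<le> k0 \<Longrightarrow> 1 \<le> ?t j"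
    using assms(1) unfolding passes_def by blast
  define k where "k = (LEAST k. w < ?t k)"
  have "w < ?t k" unfolding k_def using k0(1) by (rule LeastI)
  moreover have "k \<le> k0" unfolding k_def using k0(1) by (rule Least_le)
  then have "1 \<le> ?t j" if "0 < j" "j \<le> k" for j
    using k0(2)[OF that(1)] that(2) by simp
  moreover have "?t j \<le> w" if "j < k" for j
    using not_less_Least[OF that[unfolded k_def]] by simp
  moreover have "0 < k"
    using \<open>w < ?t k\<close> assms(2) by (cases k) auto
  ultimately show thesis by (intro that)
qed

lemma passes_cong:
  assumes n: "n \<ge> 1" and w: "0 \<le> w" and y: "y \<in> {0..<2 * int n}"
    and eq: "\<And>v. v \<in> block n 0 w \<Longrightarrow> \<omega> v = \<omega>' v" and "passes n w \<omega> y"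
  shows "passes n w \<omega>' y"
proof -
  let ?t = "trajectory (cylinder n) \<omega> (entry y)"
  obtain k where k: "0 < k" "w < col (?t k)" "\<And>j. 0 < j \<Longrightarrow> j \<le> k \<Longrightarrow> 1 \<le> col (?t j)"
    "\<And>j. j < k \<Longrightarrow> col (?t j) \<le> w"
    using passes_minimal[OF assms(5) w] by blast
  have eq': "trajectory (cylinder n) \<omega>' (entry y) j = ?t j" if "j < k" for j
  proof (rule trajectory_cong)
    fix i assume i: "0 < i" "i \<le> j"
    have "fst (?t i) \<in> cylinder_vertices n"
      by (rule trajectory_in_vertices[OF n entry_in_vertices[OF y]])
    then have "fst (?t i) \<in> block n 0 w"
      using k(3)[of i] k(4)[of i] i that
      by (auto simp: block_def cylinder_vertices_def col_def mem_Times_iff)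
    then show "\<omega>' (fst (?t i)) = \<omega> (fst (?t i))" using eq by simp
  qed
  \<comment> \<open>The exit vertex at time \<open>k\<close> lies outside the block, but its column
    is already fixed by the edge leading to it, before its state is read.\<close>
  have "col (trajectory (cylinder n) \<omega>' (entry y) k) = col (?t k)"
    using k(1) eq'[of "k - 1"] by (cases k) (simp_all add: trajectory_Suc col_next_edge)
  then have "col (trajectory (cylinder n) \<omega>' (entry y) j) = col (?t j)" if "j \<le> k" for j
    using eq'[of j] that by (cases "j = k") auto
  then show ?thesis
    unfolding passes_def using k by (intro exI[of _ k]) auto
qed

lemma passing_cong:
  assumes "n \<ge> 1" "0 \<le> w" "\<And>v. v \<in> block n 0 w \<Longrightarrow> \<omega> v = \<omega>' v"
  shows "passing n w \<omega> = passing n w \<omega>'"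
proof -
  have "passes n w \<omega> y \<longleftrightarrow> passes n w \<omega>' y" if y: "y \<in> {0..<2 * int n}" for y
  proof
    show "passes n w \<omega>' y" if "passes n w \<omega> y"
      by (rule passes_cong[OF assms(1,2) y _ that]) (rule assms(3))
    show "passes n w \<omega> y" if "passes n w \<omega>' y"
      by (rule passes_cong[OF assms(1,2) y _ that]) (rule assms(3)[symmetric])
  qed
  then show ?thesis unfolding passing_def by blast
qed

lemma not_passesI:
  assumes "0 < k" "col (trajectory (cylinder n) \<omega> (entry y) k) \<le> 0" "0 \<le> w"
    and "\<And>j. j < k \<Longrightarrow> col (trajectory (cylinder n) \<omega> (entry y) j) \<le> w"
  shows "\<not> passes n w \<omega> y"
proof
  assume "passes n w \<omega> y"
  then obtain l where l: "w < col (trajectory (cylinder n) \<omega> (entry y) l)"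
    "\<And>j. 0 < j \<Longrightarrow> j \<le> l \<Longrightarrow> 1 \<le> col (trajectory (cylinder n) \<omega> (entry y) j)"
    unfolding passes_def by blast
  have "k \<le> l" using assms(4)[of l] l(1) by linarith
  then show False using l(2)[OF assms(1)] assms(2) by simp
qed

text \<open>Confined forever to the finite strip of columns 1 to \<open>w\<close>, the trajectory
  would repeat an edge; pasts being unique, it would then come back to its entry edge, which starts
  in column 0. So it leaves the strip, necessarily on the left.\<close>

lemma not_passes_returns:
  assumes n: "n \<ge> 1" and w: "0 \<le> w" and y: "y \<in> {0..<2 * int n}"
    and np: "\<not> passes n w \<omega> y"
  obtains k y' where "y' \<in> {0..<2 * int n}"
    "\<And>j. 0 < j \<Longrightarrow> j \<le> k \<Longrightarrow> col (trajectory (cylinder n) \<omega> (entry y) j) \<in> {1..w}"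
    "trajectory (cylinder n) \<omega> (entry y) k = rev_edge (cylinder n) (entry y')"
proof -
  let ?t = "trajectory (cylinder n) \<omega> (entry y)"
  have V: "fst (?t k) \<in> cylinder_vertices n" for k
    by (rule trajectory_in_vertices[OF n entry_in_vertices[OF y]])
  have "\<exists>k>0. col (?t k) \<notin> {1..w}"
  proof (rule ccontr)
    assume *: "\<not> ?thesis"
    have fin: "finite (({0..w} \<times> {0..<2 * int n}) \<times> (UNIV :: dir set))"
    proof -
      have "(UNIV :: dir set) = {North, East, South, West}" using dir.exhaust by auto
      then have "finite (UNIV :: dir set)" by (metis finite.simps)
      then show ?thesis by simp
    qed
    have *: "col (?t k) \<in> {1..w}" if "0 < k" for k using * that by blast
    have "col (?t k) \<in> {0..w}" for k
      using *[of k] w by (cases "k = 0") auto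
    then have "?t k \<in> ({0..w} \<times> {0..<2 * int n}) \<times> UNIV" for k
      using V[of k] by (simp add: col_def cylinder_vertices_def mem_Times_iff)
    then have "finite (range ?t)"
      using finite_subset[OF _ fin] by blast
    then have "\<not> inj ?t"
      using range_inj_infinite by blast
    then obtain a b where ab: "a < b" "?t a = ?t b"
      unfolding inj_def by (metis linorder_neqE_nat)
    have "?t (b - a) = entry y"
      by (rule trajectory_backtrack[OF n, where k = a]) (use ab y in \<open>auto simp: entry_in_vertices\<close>)
    moreover have "col (?t (b - a)) \<in> {1..w}" using * ab(1) by simp
    ultimately show False by simp
  qed
  then have ex: "\<exists>k. 0 < k \<and> col (?t k) \<notin> {1..w}" by blast
  define k where "k = (LEAST k. 0 < k \<and> col (?t k) \<notin> {1..w})"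
  have k: "0 < k" "col (?t k) \<notin> {1..w}"
    using LeastI_ex[OF ex] unfolding k_def by auto
  have less: "col (?t j) \<in> {1..w}" if "0 < j" "j < k" for j
    using not_less_Least[OF that(2)[unfolded k_def]] that(1) by blast
  have "col (?t k) \<le> 0"
  proof (rule ccontr)
    assume pos: "\<not> ?thesis"
    then have "1 \<le> col (?t j)" if "0 < j" "j \<le> k" for j
      using less[of j] that by (cases "j = k") auto
    then have "passes n w \<omega> y"
      unfolding passes_def using k pos by (intro exI[of _ k]) auto
    then show False using np by simp
  qed
  define l where "l = k - 1"
  have kl: "k = Suc l" using k(1) by (simp add: l_def)
  have step: "col (?t k) = col (?t l) + fst (dir_vec (snd (?t l)))"
    by (simp add: kl trajectory_Suc col_next_edge)
  have "l \<noteq> 0"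
  proof
    assume "l = 0"
    then show False using step \<open>col (?t k) \<le> 0\<close> by (simp add: entry_def col_def)
  qed
  then have "snd (?t l) = West \<and> col (?t l) = 1"
    using less[of l] kl \<open>col (?t k) \<le> 0\<close> step by (cases "snd (?t l)") simp_all
  then have 1: "?t l = rev_edge (cylinder n) (entry (snd (fst (?t l))))"
    using V[of l] by (cases "?t l") (auto simp: entry_def rev_edge_def cylinder_def col_def cylinder_vertices_def)
  have 2: "snd (fst (?t l)) \<in> {0..<2 * int n}"
    using V[of l] by (auto simp: cylinder_vertices_def)
  have 3: "col (?t j) \<in> {1..w}" if "0 < j" "j \<le> l" for j
    using less[of j] that kl by simp
  show thesis by (rule that[OF 2 3 1])
qed

lemma even_card_involution:
  fixes f :: "'a :: linorder \<Rightarrow> 'a"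
  assumes "finite A" "\<And>x. x \<in> A \<Longrightarrow> f x \<in> A" "\<And>x. x \<in> A \<Longrightarrow> f (f x) = x"
    and "\<And>x. x \<in> A \<Longrightarrow> f x \<noteq> x"
  shows "even (card A)"
proof -
  let ?U = "{x \<in> A. x < f x}" and ?D = "{x \<in> A. f x < x}"
  have "bij_betw f ?U ?D"
    by (rule bij_betw_byWitness[where f' = f]) (use assms in auto)
  then have "card ?U = card ?D" by (rule bij_betw_same_card)
  moreover have "A = ?U \<union> ?D" using assms(4) by (auto simp: neq_iff)
  then have "card A = card ?U + card ?D"
    using card_Un_disjoint[of ?U ?D] assms(1) by fastforce
  ultimately show ?thesis by simp
qed

text \<open>The trajectories that enter from the left and return to the left are matched in pairs by
  time reversal, and the number of entries is even.\<close>

lemma card_passing_neq_1: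
  assumes n: "n \<ge> 1" and w: "0 \<le> w"
  shows "card (passing n w \<omega>) \<noteq> 1"
proof -
  let ?C = "cylinder n"
  let ?T = "{0..<2 * int n} - passing n w \<omega>"
  define R where "R y y' \<longleftrightarrow> (\<exists>k. (\<forall>j. 0 < j \<and> j \<le> k \<longrightarrow> col (trajectory ?C \<omega> (entry y) j) \<in> {1..w}) \<and>
      trajectory ?C \<omega> (entry y) k = rev_edge ?C (entry y'))" for y y'
  have ex: "\<exists>y'. y' \<in> {0..<2 * int n} \<and> R y y'" if y: "y \<in> ?T" for y
  proof -
    have "y \<in> {0..<2 * int n}" "\<not> passes n w \<omega> y" using y by (auto simp: passing_def)
    then show ?thesis
      by (rule not_passes_returns[OF n w]) (unfold R_def, blast)
  qed
  have next0: "col (next_edge ?C \<omega> (rev_edge ?C (entry y))) = 0" for y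
    by (simp add: next_edge_Pair rev_edge_def entry_def cylinder_def col_def)
  have np: "\<not> passes n w \<omega> y" if R: "R y y'" for y y'
  proof -
    obtain k where k: "\<And>j. 0 < j \<Longrightarrow> j \<le> k \<Longrightarrow> col (trajectory ?C \<omega> (entry y) j) \<in> {1..w}"
      "trajectory ?C \<omega> (entry y) k = rev_edge ?C (entry y')"
      using R unfolding R_def by blast
    have "col (trajectory ?C \<omega> (entry y) j) \<le> w" if "j < Suc k" for j
      using k(1)[of j] that w by (cases "j = 0") auto
    then show ?thesis
      using not_passesI[of "Suc k"] k(2) w by (simp add: trajectory_Suc next0)
  qed
  have sym: "R y' y" if R: "R y y'" and y: "y \<in> {0..<2 * int n}" "y' \<in> {0..<2 * int n}" for y y'
  proof -
    obtain k where k: "\<And>j. 0 < j \<Longrightarrow> j \<le> k \<Longrightarrow> col (trajectory ?C \<omega> (entry y) j) \<in> {1..w}"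
      "trajectory ?C \<omega> (entry y) k = rev_edge ?C (entry y')"
      using R unfolding R_def by blast
    have rev: "trajectory ?C \<omega> (entry y') j = rev_edge ?C (trajectory ?C \<omega> (entry y) (k - j))"
      if "j \<le> k" for j
      using trajectory_rev_edge[OF n that, of \<omega> "entry y"] k(2)
      by (simp add: rev_edge_rev_edge[OF entry_in_vertices[OF y(2)]])
    have "col (trajectory ?C \<omega> (entry y') j) \<in> {1..w}" if j: "0 < j" "j \<le> k" for j
    proof -
      \<comment> \<open>A reversed edge starts where the original one ends, hence the shift by one
        in time.\<close>
      have "col (trajectory ?C \<omega> (entry y') j) = col (trajectory ?C \<omega> (entry y) (Suc (k - j)))"
        by (simp add: rev[OF j(2)] trajectory_Suc col_def rev_edge_def fst_next_edge)
      then show ?thesis using k(1)[of "Suc (k - j)"] j by simp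
    qed
    moreover have "trajectory ?C \<omega> (entry y') k = rev_edge ?C (entry y)"
      using rev[of k] by simp
    ultimately show ?thesis unfolding R_def by blast
  qed
  have uniq: "y1 = y2" if R: "R y y1" "R y y2"
    and y: "y1 \<in> {0..<2 * int n}" "y2 \<in> {0..<2 * int n}" for y y1 y2
  proof -
    \<comment> \<open>One step after a return edge the trajectory is in column 0, so the return time
      is unique.\<close>
    have le: "k2 \<le> k1"
      if "trajectory ?C \<omega> (entry y) k1 = rev_edge ?C (entry y1)"
        and "\<And>j. 0 < j \<Longrightarrow> j \<le> k2 \<Longrightarrow> col (trajectory ?C \<omega> (entry y) j) \<in> {1..w}" for k1 k2 y1
    proof (rule ccontr)
      assume "\<not> k2 \<le> k1"
      then have "col (trajectory ?C \<omega> (entry y) (Suc k1)) \<in> {1..w}" using that(2) by simp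
      then show False using that(1) next0 by (simp add: trajectory_Suc)
    qed
    obtain k1 k2 where
      k1: "\<And>j. 0 < j \<Longrightarrow> j \<le> k1 \<Longrightarrow> col (trajectory ?C \<omega> (entry y) j) \<in> {1..w}"
        "trajectory ?C \<omega> (entry y) k1 = rev_edge ?C (entry y1)" and
      k2: "\<And>j. 0 < j \<Longrightarrow> j \<le> k2 \<Longrightarrow> col (trajectory ?C \<omega> (entry y) j) \<in> {1..w}"
        "trajectory ?C \<omega> (entry y) k2 = rev_edge ?C (entry y2)"
      using R unfolding R_def by blast
    have "k1 = k2" by (rule antisym[OF le[OF k2(2) k1(1)] le[OF k1(2) k2(1)]])
    then have "rev_edge ?C (entry y1) = rev_edge ?C (entry y2)" using k1(2) k2(2) by simp
    then have "rev_edge ?C (rev_edge ?C (entry y1)) = rev_edge ?C (rev_edge ?C (entry y2))"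
      by (rule arg_cong)
    then have "entry y1 = entry y2"
      unfolding rev_edge_rev_edge[OF entry_in_vertices[OF y(1)]]
        rev_edge_rev_edge[OF entry_in_vertices[OF y(2)]] .
    then show ?thesis by (simp add: entry_def)
  qed
  define f where "f y = (SOME y'. y' \<in> {0..<2 * int n} \<and> R y y')" for y
  have f: "f y \<in> {0..<2 * int n}" "R y (f y)" if "y \<in> ?T" for y
    using someI_ex[OF ex[OF that], folded f_def] by simp_all
  have T: "y \<in> {0..<2 * int n}" if "y \<in> ?T" for y using that by blast
  have "even (card ?T)"
  proof (rule even_card_involution[where f = f])
    fix y assume y: "y \<in> ?T"
    have R': "R (f y) y" using sym[OF f(2)[OF y] T[OF y] f(1)[OF y]] .
    show fT: "f y \<in> ?T" using f(1)[OF y] np[OF R'] by (simp add: passing_def)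
    show "f (f y) = y" by (rule uniq[OF f(2)[OF fT] R' f(1)[OF fT] T[OF y]])
    \<comment> \<open>A fixed point would be a trajectory that arrives at the reversal of its own
      entry edge.\<close>
    show "f y \<noteq> y"
    proof
      assume "f y = y"
      then obtain k where "trajectory ?C \<omega> (entry y) k = rev_edge ?C (entry y)"
        using f(2)[OF y] unfolding R_def by auto
      then show False using trajectory_neq_rev_edge[OF n entry_in_vertices[OF T[OF y]]] by blast
    qed
  qed simp
  moreover have "card ?T = 2 * n - card (passing n w \<omega>)"
    using card_Diff_subset[OF _ passing_subset[of n w \<omega>]] by simp
  ultimately have "even (2 * n - card (passing n w \<omega>))" by simp
  then show ?thesis using n by fastforce
qed

section \<open>Winding loops\<close>

text \<open>The last clause says that the first edge is the only one across the cut between the rows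
  \<open>0\<close> and \<open>1\<close>, so that the loop winds exactly once.\<close>

definition winding_loop :: "nat \<Rightarrow> int \<Rightarrow> int \<Rightarrow> env \<Rightarrow> dedge \<Rightarrow> nat \<Rightarrow> bool" where
  "winding_loop n w w' \<omega> e T \<longleftrightarrow> 0 < T \<and> fst e \<in> cylinder_vertices n \<and>
     trajectory (cylinder n) \<omega> e T = e \<and>
     (\<forall>k<T. w < col (trajectory (cylinder n) \<omega> e k) \<and> col (trajectory (cylinder n) \<omega> e k) \<le> w') \<and>
     snd (fst e) = 0 \<and> snd e = North \<and>
     (\<forall>k. 0 < k \<and> k < T \<longrightarrow>
        \<not> (snd (fst (trajectory (cylinder n) \<omega> e k)) = 0 \<and> snd (trajectory (cylinder n) \<omega> e k) = North) \<and>
        \<not> (snd (fst (trajectory (cylinder n) \<omega> e k)) = 1 \<and> snd (trajectory (cylinder n) \<omega> e k) = South))"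

definition loop_vertices :: "nat \<Rightarrow> env \<Rightarrow> dedge \<Rightarrow> vertex set" where
  "loop_vertices n \<omega> e = range (\<lambda>k. fst (trajectory (cylinder n) \<omega> e k))"

text \<open>The contribution of an edge to the net upward flux through the horizontal ray that starts
  just above the vertex \<open>(x, y)\<close>, exclusive of its column, and extends to the left.\<close>

definition flux :: "nat \<Rightarrow> vertex \<Rightarrow> dedge \<Rightarrow> int" where
  "flux n v e =
     of_bool (snd e = North \<and> snd (fst e) = snd v \<and> col e < fst v) -
     of_bool (snd e = South \<and> snd (fst e) = (snd v + 1) mod (2 * int n) \<and> col e < fst v)"

lemma succ_mod_eq_iff:
  assumes "n \<ge> 1" "a \<in> {0..<2 * int n}" "b \<in> {0..<2 * int n}"
  shows "(a + 1) mod (2 * int n) = (b + 1) mod (2 * int n) \<longleftrightarrow> a = b"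
proof
  assume "(a + 1) mod (2 * int n) = (b + 1) mod (2 * int n)"
  then have "(a + 1 - 1) mod (2 * int n) = (b + 1 - 1) mod (2 * int n)"
    by (metis mod_diff_left_eq)
  then show "a = b" using assms by simp
qed simp

lemma pred_mod_eq_iff:
  assumes "n \<ge> 1" "a \<in> {0..<2 * int n}" "b \<in> {0..<2 * int n}"
  shows "(a - 1) mod (2 * int n) = b \<longleftrightarrow> a = (b + 1) mod (2 * int n)"
proof -
  have "(a - 1) mod (2 * int n) = b \<longleftrightarrow> ((a - 1) mod (2 * int n) + 1) mod (2 * int n) = (b + 1) mod (2 * int n)"
    using assms by (intro succ_mod_eq_iff[symmetric]) auto
  also have "((a - 1) mod (2 * int n) + 1) mod (2 * int n) = a"
    using assms by (simp add: mod_add_left_eq)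
  finally show ?thesis by auto
qed

text \<open>Flux balance on the part of a row to the left of a given vertex: a step that avoids
  that vertex enters or leaves this part only vertically.\<close>

lemma flux_vertical:
  fixes n x y e
  defines "y' \<equiv> (y + 1) mod (2 * int n)"
  defines "h \<equiv> \<lambda>v. of_bool (snd v = y' \<and> fst v < x) :: int"
  assumes n: "n \<ge> 1" and y: "y \<in> {0..<2 * int n}" and e: "fst e \<in> cylinder_vertices n"
    and avoid: "fst e \<noteq> (x, y')" "cylinder n (fst e) (snd e) \<noteq> (x, y')"
  shows "h (cylinder n (fst e) (snd e)) - h (fst e) = flux n (x, y) e - flux n (x, y') e"
proof -
  obtain a b d where abd: "e = ((a, b), d)" by (metis prod.exhaust)
  have b: "b \<in> {0..<2 * int n}" using e by (simp add: abd cylinder_vertices_def)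
  have y': "y' \<in> {0..<2 * int n}" using n by (simp add: y'_def)
  have N: "(b + 1) mod (2 * int n) = y' \<longleftrightarrow> b = y"
    unfolding y'_def by (rule succ_mod_eq_iff[OF n b y])
  have S: "(b - 1) mod (2 * int n) = y' \<longleftrightarrow> b = (y' + 1) mod (2 * int n)"
    by (rule pred_mod_eq_iff[OF n b y'])
  have b0: "b mod (2 * int n) = b" using b by simp
  show ?thesis
  proof (cases d)
    case North
    then show ?thesis using N by (simp add: abd h_def flux_def col_def cylinder_def)
  next
    case South
    then show ?thesis using S by (simp add: abd h_def flux_def col_def cylinder_def y'_def)
  next
    case East
    then show ?thesis using avoid b0 by (auto simp: abd h_def flux_def col_def cylinder_def)
  next
    case West
    then show ?thesis using avoid b0 by (auto simp: abd h_def flux_def col_def cylinder_def)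
  qed
qed

text \<open>The two rays differ by the vertical edge above \<open>(x, y)\<close>, and that edge has
  an end at the avoided vertex.\<close>

lemma flux_horizontal:
  assumes n: "n \<ge> 1" and y: "y \<in> {0..<2 * int n}"
    and avoid: "fst e \<noteq> (x, y)" "cylinder n (fst e) (snd e) \<noteq> (x, y)"
  shows "flux n (x + 1, y) e = flux n (x, y) e"
proof -
  obtain a b d where abd: "e = ((a, b), d)" by (metis prod.exhaust)
  have "((y + 1) mod (2 * int n) - 1) mod (2 * int n) = y"
    using y by (simp add: mod_diff_left_eq)
  then show ?thesis
    using avoid by (cases d) (auto simp: abd flux_def col_def cylinder_def)
qed

section \<open>Separation by a winding loop\<close>

context
  fixes n :: nat and w w' :: int and \<omega> :: env and e :: dedge and T :: nat
  assumes n: "n \<ge> 1" and loop: "winding_loop n w w' \<omega> e T"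
begin

abbreviation (input) \<sigma> where "\<sigma> k \<equiv> trajectory (cylinder n) \<omega> e k"

text \<open>The algebraic intersection number of the loop with the leftward ray just above
  \<open>v\<close>; it tells the two sides of the loop apart.\<close>

definition side :: "vertex \<Rightarrow> int" where
  "side v = (\<Sum>k<T. flux n v (\<sigma> k))"

lemma loop_in_vertices: "fst (\<sigma> k) \<in> cylinder_vertices n"
  using loop by (intro trajectory_in_vertices[OF n]) (simp add: winding_loop_def)

lemma loop_period: "\<sigma> (k + T * m) = \<sigma> k"
proof (induction m)
  case (Suc m)
  have "\<sigma> (T + (k + T * m)) = \<sigma> (k + T * m)"
    using loop by (simp add: trajectory_add winding_loop_def)
  then show ?case using Suc by (simp add: algebra_simps)
qed simp

lemma loop_col: "w < col (\<sigma> k)" "col (\<sigma> k) \<le> w'"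
proof -
  have "\<sigma> k = \<sigma> (k mod T)"
    using loop_period[of "k mod T" "k div T"] by simp
  moreover have "k mod T < T" using loop by (simp add: winding_loop_def)
  ultimately show "w < col (\<sigma> k)" "col (\<sigma> k) \<le> w'"
    using loop by (auto simp: winding_loop_def)
qed

lemma loop_vertices_subset: "loop_vertices n \<omega> e \<subseteq> block n w w'"
proof -
  have "fst (\<sigma> k) \<in> block n w w'" for k
    using loop_col[of k] loop_in_vertices[of k]
    by (simp add: block_def cylinder_vertices_def col_def mem_Times_iff)
  then show ?thesis by (auto simp only: loop_vertices_def)
qed

lemma loop_vertices_step:
  "fst (\<sigma> k) \<in> loop_vertices n \<omega> e"
  "cylinder n (fst (\<sigma> k)) (snd (\<sigma> k)) \<in> loop_vertices n \<omega> e"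
proof -
  show "fst (\<sigma> k) \<in> loop_vertices n \<omega> e" for k by (simp add: loop_vertices_def)
  from this[of "Suc k"] show "cylinder n (fst (\<sigma> k)) (snd (\<sigma> k)) \<in> loop_vertices n \<omega> e"
    by (simp add: trajectory_Suc fst_next_edge)
qed

text \<open>The fluxes through the two rays differ by the net number of times the loop enters the
  piece of row between them. Along a closed loop this telescopes to zero.\<close>

lemma side_vertical:
  assumes y: "y \<in> {0..<2 * int n}" and avoid: "(x, (y + 1) mod (2 * int n)) \<notin> loop_vertices n \<omega> e"
  shows "side (x, (y + 1) mod (2 * int n)) = side (x, y)"
proof -
  define y' where "y' = (y + 1) mod (2 * int n)"
  define h where "h v = (of_bool (snd v = y' \<and> fst v < x) :: int)" for v :: vertex
  have "flux n (x, y) (\<sigma> k) - flux n (x, y') (\<sigma> k) = h (fst (\<sigma> (Suc k))) - h (fst (\<sigma> k))" for k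
    unfolding y'_def h_def trajectory_Suc fst_next_edge
    by (rule flux_vertical[OF n y loop_in_vertices, symmetric])
       (use avoid loop_vertices_step[of k] in auto)
  then have "side (x, y) - side (x, y') = (\<Sum>k<T. h (fst (\<sigma> (Suc k))) - h (fst (\<sigma> k)))"
    unfolding side_def by (simp flip: sum_subtractf)
  also have "\<dots> = 0"
    using loop by (subst sum_lessThan_telescope) (simp add: winding_loop_def)
  finally show ?thesis by (simp add: y'_def)
qed

lemma side_horizontal:
  assumes y: "y \<in> {0..<2 * int n}" and avoid: "(x, y) \<notin> loop_vertices n \<omega> e"
  shows "side (x + 1, y) = side (x, y)"
proof -
  have "flux n (x + 1, y) (\<sigma> k) = flux n (x, y) (\<sigma> k)" for k
    by (rule flux_horizontal[OF n y]) (use avoid loop_vertices_step[of k] in auto)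
  then show ?thesis by (simp add: side_def)
qed

lemma side_step:
  assumes v: "v \<in> cylinder_vertices n"
    and avoid: "v \<notin> loop_vertices n \<omega> e" "cylinder n v d \<notin> loop_vertices n \<omega> e"
  shows "side (cylinder n v d) = side v"
proof -
  obtain x y where xy: "v = (x, y)" by fastforce
  have y: "y \<in> {0..<2 * int n}" using v by (simp add: xy cylinder_vertices_def)
  then have y0: "y mod (2 * int n) = y" by simp
  show ?thesis
  proof (cases d)
    case North
    then show ?thesis using avoid side_vertical[OF y] by (simp add: xy cylinder_def)
  next
    case South
    define z where "z = (y - 1) mod (2 * int n)"
    have z: "z \<in> {0..<2 * int n}" using n by (simp add: z_def)
    have "(z + 1) mod (2 * int n) = y" using y by (simp add: z_def mod_add_left_eq)
    then show ?thesis using avoid side_vertical[OF z, of x] South by (simp add: xy cylinder_def z_def)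
  next
    case East
    then show ?thesis using avoid side_horizontal[OF y] y0 by (simp add: xy cylinder_def)
  next
    case West
    then show ?thesis using avoid side_horizontal[OF y, of "x - 1"] y0 by (simp add: xy cylinder_def)
  qed
qed

lemma side_left:
  assumes "fst v \<le> w" shows "side v = 0"
proof -
  have "flux n v (\<sigma> k) = 0" for k
    using loop_col[of k] assms by (simp add: flux_def)
  then show ?thesis by (simp add: side_def)
qed

text \<open>To the right of the loop the ray in row 0 catches every crossing of the cut, and the
  first edge is the only one. The other rows follow by moving the ray upwards past no loop
  vertex.\<close>

lemma side_right:
  assumes x: "w' < x" and y: "y \<in> {0..<2 * int n}"
  shows "side (x, y) = 1"
proof -
  have out: "(x, z) \<notin> loop_vertices n \<omega> e" for z
    using loop_vertices_subset x by (auto simp: block_def)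
  have "flux n (x, 0) (\<sigma> k) = of_bool (k = 0)" if "k < T" for k
  proof (cases "k = 0")
    case True
    then show ?thesis using loop loop_col[of 0] x by (simp add: flux_def winding_loop_def)
  next
    case False
    moreover have "1 mod (2 * int n) = 1" using n by simp
    ultimately show ?thesis using loop that by (auto simp: flux_def winding_loop_def)
  qed
  then have "side (x, 0) = (\<Sum>k<T. of_bool (k = 0))"
    unfolding side_def by (intro sum.cong) auto
  also have "\<dots> = 1"
    using loop by (simp add: winding_loop_def sum.delta of_bool_def)
  finally have 0: "side (x, 0) = 1" .
  have "side (x, int k) = 1" if "int k < 2 * int n" for k
    using that
  proof (induction k)
    case (Suc k)
    then show ?case using side_vertical[of "int k" x] out by (simp add: add.commute)
  qed (use 0 in simp)
  from this[of "nat y"] show ?thesis using y by simp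
qed

text \<open>\<open>side\<close> is 0 at the entry and 1 beyond column \<open>w'\<close>, and it is
  constant along steps that avoid the loop. The first meeting time is recorded because the part
  before it is unaffected by changes on the loop.\<close>

lemma passes_hits_loop:
  assumes w: "0 \<le> w" "w \<le> w'" and y: "y \<in> {0..<2 * int n}" and p: "passes n w' \<omega> y"
  obtains a where "0 < a" "fst (trajectory (cylinder n) \<omega> (entry y) a) \<in> loop_vertices n \<omega> e"
    "\<And>j. j < a \<Longrightarrow> fst (trajectory (cylinder n) \<omega> (entry y) j) \<notin> loop_vertices n \<omega> e"
    "\<And>j. j \<le> a \<Longrightarrow> col (trajectory (cylinder n) \<omega> (entry y) j) \<le> w'"
    "\<And>j. 0 < j \<Longrightarrow> j \<le> a \<Longrightarrow> 1 \<le> col (trajectory (cylinder n) \<omega> (entry y) j)"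
proof -
  let ?t = "trajectory (cylinder n) \<omega> (entry y)"
  let ?S = "loop_vertices n \<omega> e"
  have V: "fst (?t k) \<in> cylinder_vertices n" for k
    by (rule trajectory_in_vertices[OF n entry_in_vertices[OF y]])
  obtain k where k: "0 < k" "w' < col (?t k)" "\<And>j. 0 < j \<Longrightarrow> j \<le> k \<Longrightarrow> 1 \<le> col (?t j)"
    "\<And>j. j < k \<Longrightarrow> col (?t j) \<le> w'"
    using passes_minimal[OF p order_trans[OF w]] by blast
  have "\<exists>a<k. fst (?t a) \<in> ?S"
  proof (rule ccontr)
    assume "\<not> ?thesis"
    moreover have "fst (?t k) \<notin> ?S"
      using loop_vertices_subset k(2) by (auto simp: block_def col_def)
    ultimately have avoid: "fst (?t a) \<notin> ?S" if "a \<le> k" for a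
      using that by (cases "a = k") auto
    have "side (fst (?t a)) = 0" if "a \<le> k" for a
      using that
    proof (induction a)
      case 0
      then show ?case using w by (simp add: entry_def side_left)
    next
      case (Suc a)
      then show ?case
        using side_step[OF V[of a] avoid[of a]] avoid[of "Suc a"] by (simp add: trajectory_Suc fst_next_edge)
    qed
    moreover have "side (fst (?t k)) = 1"
      using side_right[of "fst (fst (?t k))" "snd (fst (?t k))"] k(2) V[of k]
      by (simp add: col_def cylinder_vertices_def mem_Times_iff)
    ultimately show False by simp
  qed
  then have ex: "\<exists>a. fst (?t a) \<in> ?S" by blast
  define a where "a = (LEAST a. fst (?t a) \<in> ?S)"
  have a: "fst (?t a) \<in> ?S" unfolding a_def using ex by (rule LeastI_ex)
  have less: "fst (?t j) \<notin> ?S" if "j < a" for j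
    using not_less_Least that unfolding a_def by blast
  obtain b where "b < k" "fst (?t b) \<in> ?S" using \<open>\<exists>a<k. fst (?t a) \<in> ?S\<close> by blast
  then have ak: "a < k" using less[of b] by force
  have "0 < a"
  proof (rule ccontr)
    assume "\<not> 0 < a"
    then have "fst (entry y) \<in> ?S" using a by simp
    then show False using loop_vertices_subset w by (auto simp: block_def entry_def)
  qed
  then show thesis
    by (rule that[OF _ a less]) (use ak k(3,4) in simp_all)
qed

end

text \<open>Two passing trajectories first meet the loop at vertices \<open>v1\<close> and \<open>v2\<close>. With new mirrors
  there, the first one turns into the loop at \<open>v1\<close>, leaves it at \<open>v2\<close> and runs back along the
  second one, so that it returns to the left.\<close>

lemma two_site_modification:
  assumes n: "n \<ge> 1" and w: "0 \<le> w" "w \<le> w'" and loop: "winding_loop n w w' \<omega> e T"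
    and y: "y1 \<in> passing n w' \<omega>" "y2 \<in> passing n w' \<omega>" "y1 \<noteq> y2"
  shows "\<exists>v\<in>block n w w'. \<exists>m. \<exists>v'\<in>block n w w'. \<exists>m'. y1 \<notin> passing n w' (\<omega> (v := m, v' := m'))"
proof -
  let ?C = "cylinder n"
  let ?S = "loop_vertices n \<omega> e"
  let ?\<gamma> = "trajectory ?C \<omega> (entry y1)" and ?\<eta> = "trajectory ?C \<omega> (entry y2)"
  let ?\<sigma> = "trajectory ?C \<omega> e"
  note sub = loop_vertices_subset[OF n loop]
  have y': "y1 \<in> {0..<2 * int n}" "y2 \<in> {0..<2 * int n}" "passes n w' \<omega> y1" "passes n w' \<omega> y2"
    using y by (auto simp: passing_def)
  have V: "fst (?\<gamma> k) \<in> cylinder_vertices n" "fst (?\<eta> k) \<in> cylinder_vertices n" for k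
    using y' by (auto intro: trajectory_in_vertices[OF n entry_in_vertices])
  obtain a where a: "0 < a" "fst (?\<gamma> a) \<in> ?S" "\<And>j. j < a \<Longrightarrow> fst (?\<gamma> j) \<notin> ?S"
    "\<And>j. j \<le> a \<Longrightarrow> col (?\<gamma> j) \<le> w'" "\<And>j. 0 < j \<Longrightarrow> j \<le> a \<Longrightarrow> 1 \<le> col (?\<gamma> j)"
    using passes_hits_loop[OF n loop w y'(1,3)] by blast
  obtain b where b: "0 < b" "fst (?\<eta> b) \<in> ?S" "\<And>j. j < b \<Longrightarrow> fst (?\<eta> j) \<notin> ?S"
    "\<And>j. j \<le> b \<Longrightarrow> col (?\<eta> j) \<le> w'" "\<And>j. 0 < j \<Longrightarrow> j \<le> b \<Longrightarrow> 1 \<le> col (?\<eta> j)"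
    using passes_hits_loop[OF n loop w y'(2,4)] by blast
  define v1 where "v1 = fst (?\<gamma> a)"
  define v2 where "v2 = fst (?\<eta> b)"
  obtain a' b' where a': "a = Suc a'" and b': "b = Suc b'"
    using a(1) b(1) by (metis gr0_implies_Suc)
  define d1 where "d1 = snd (?\<gamma> a')"
  define d2 where "d2 = snd (?\<eta> b')"
  have v1: "v1 = ?C (fst (?\<gamma> a')) d1" by (simp add: v1_def d1_def a' trajectory_Suc fst_next_edge)
  have v2: "v2 = ?C (fst (?\<eta> b')) d2" by (simp add: v2_def d2_def b' trajectory_Suc fst_next_edge)
  have in_block: "v1 \<in> block n w w'" "v2 \<in> block n w w'"
    using a(2) b(2) sub by (auto simp: v1_def v2_def)

  \<comment> \<open>Both changed vertices lie on the loop, which the first trajectory does not touch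
    before time \<open>a\<close>.\<close>
  have before: "trajectory ?C \<omega>' (entry y1) j = ?\<gamma> j"
    if "\<And>v. v \<notin> {v1, v2} \<Longrightarrow> \<omega>' v = \<omega> v" "j < a" for \<omega>' j
  proof (rule trajectory_cong)
    fix i assume "0 < i" "i \<le> j"
    then have "fst (?\<gamma> i) \<notin> ?S" using a(3)[of i] that(2) by simp
    then have "fst (?\<gamma> i) \<notin> {v1, v2}" using a(2) b(2) by (auto simp: v1_def v2_def)
    then show "\<omega>' (fst (?\<gamma> i)) = \<omega> (fst (?\<gamma> i))" by (rule that(1))
  qed
  \<comment> \<open>The edge \<open>(v2, opposite d2)\<close> reverses the last edge of the second
    trajectory before the loop; from it one runs back to column 0, again through vertices off the
    loop.\<close>
  have backwards: "trajectory ?C \<omega>' (v2, opposite d2) j = rev_edge ?C (?\<eta> (b' - j))"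
    if "\<And>v. v \<notin> {v1, v2} \<Longrightarrow> \<omega>' v = \<omega> v" "j \<le> b'" for \<omega>' j
  proof -
    have start: "(v2, opposite d2) = rev_edge ?C (?\<eta> b')"
      by (simp add: rev_edge_def v2 d2_def)
    have "trajectory ?C \<omega>' (v2, opposite d2) j = trajectory ?C \<omega> (v2, opposite d2) j"
    proof (rule trajectory_cong)
      fix i assume i: "0 < i" "i \<le> j"
      have "fst (trajectory ?C \<omega> (v2, opposite d2) i) = fst (?\<eta> (Suc (b' - i)))"
        unfolding start using trajectory_rev_edge[OF n, of i b' \<omega> "entry y2"] i that(2)
        by (simp add: rev_edge_def trajectory_Suc fst_next_edge)
      moreover have "fst (?\<eta> (Suc (b' - i))) \<notin> ?S"
        using b(3) i that(2) b' by simp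
      ultimately have "fst (trajectory ?C \<omega> (v2, opposite d2) i) \<notin> {v1, v2}"
        using a(2) b(2) by (auto simp: v1_def v2_def)
      then show "\<omega>' (fst (trajectory ?C \<omega> (v2, opposite d2) i)) =
          \<omega> (fst (trajectory ?C \<omega> (v2, opposite d2) i))"
        by (rule that(1))
    qed
    also have "\<dots> = rev_edge ?C (?\<eta> (b' - j))"
      unfolding start by (rule trajectory_rev_edge[OF n that(2)])
    finally show ?thesis .
  qed
  \<comment> \<open>It remains to steer the first trajectory to that edge without exceeding column
    \<open>w'\<close>.\<close>
  have conclude: "y1 \<notin> passing n w' \<omega>'"
    if \<omega>': "\<And>v. v \<notin> {v1, v2} \<Longrightarrow> \<omega>' v = \<omega> v"
      and c: "a \<le> c" "trajectory ?C \<omega>' (entry y1) c = (v2, opposite d2)"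
      "\<And>j. a \<le> j \<Longrightarrow> j < c \<Longrightarrow> col (trajectory ?C \<omega>' (entry y1) j) \<le> w'" for \<omega>' c
  proof -
    have later: "trajectory ?C \<omega>' (entry y1) (c + j) = rev_edge ?C (?\<eta> (b' - j))" if "j \<le> b'" for j
      using backwards[OF \<omega>' that] c(2) by (simp add: trajectory_add)
    have "col (trajectory ?C \<omega>' (entry y1) (Suc (c + b'))) = 0"
      using later[of b']
      by (simp add: trajectory_Suc next_edge_Pair col_def fst_next_edge rev_edge_def entry_def cylinder_def)
    moreover have "col (trajectory ?C \<omega>' (entry y1) j) \<le> w'" if "j < Suc (c + b')" for j
    proof -
      consider "j < a" | "a \<le> j" "j < c" | "c \<le> j" by linarith
      then show ?thesis
      proof cases
        case 1
        then show ?thesis using before[OF \<omega>' 1] a(4)[of j] by simp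
      next
        case 2
        then show ?thesis by (rule c(3))
      next
        case 3
        define i where "i = j - c"
        have i: "j = c + i" "i \<le> b'" using 3 that by (simp_all add: i_def)
        have "col (trajectory ?C \<omega>' (entry y1) j) = col (?\<eta> (Suc (b' - i)))"
          using later[OF i(2)] by (simp add: i(1) col_def rev_edge_def trajectory_Suc fst_next_edge)
        then show ?thesis using b(4)[of "Suc (b' - i)"] b' by simp
      qed
    qed
    ultimately have "\<not> passes n w' \<omega>' y1"
      using w by (intro not_passesI[of "Suc (c + b')"]) auto
    then show ?thesis by (simp add: passing_def)
  qed
  have arrive: "trajectory ?C \<omega>' (entry y1) a = (v1, paired (\<omega>' v1) (opposite d1))"
    if "\<And>v. v \<notin> {v1, v2} \<Longrightarrow> \<omega>' v = \<omega> v" for \<omega>'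
    using before[OF that, of a'] by (simp add: a' trajectory_Suc v1 d1_def next_edge_def Let_def)

  show ?thesis
  proof (cases "v1 = v2")
    case True
    \<comment> \<open>A single mirror joins the two arrivals if they differ. Equal arrivals would
      mean a common edge, and tracing it back would put the entry edge of one trajectory on the
      other.\<close>
    have "d1 \<noteq> d2"
    proof
      assume "d1 = d2"
      then have "?\<gamma> a' = ?\<eta> b'"
        using v1 v2 True V cylinder_opposite by (metis d1_def d2_def prod.collapse)
      show False
      proof (cases "a' \<le> b'")
        case True
        have eq: "?\<eta> (b' - a') = entry y1"
          by (rule trajectory_backtrack[OF n, where k = a'])
            (use \<open>?\<gamma> a' = ?\<eta> b'\<close> True y' in \<open>auto simp: entry_in_vertices\<close>)
        show False
        proof (cases "b' - a' = 0")
          case True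
          then show False using eq y(3) by (simp add: entry_def)
        next
          case False
          moreover have "b' - a' \<le> b" using b' by linarith
          ultimately show False using b(5)[of "b' - a'"] by (simp add: eq)
        qed
      next
        case False
        have eq: "?\<gamma> (a' - b') = entry y2"
          by (rule trajectory_backtrack[OF n, where k = b'])
            (use \<open>?\<gamma> a' = ?\<eta> b'\<close> False y' in \<open>auto simp: entry_in_vertices\<close>)
        have "a' - b' \<le> a" using a' by linarith
        then show False using a(5)[of "a' - b'"] False by (simp add: eq)
      qed
    qed
    then obtain m where m: "paired m (opposite d1) = opposite d2"
      using ex_paired[of "opposite d1" "opposite d2"] by auto
    have "y1 \<notin> passing n w' (\<omega> (v1 := m, v2 := m))"
      by (rule conclude[of _ a]) (use arrive[of "\<omega> (v1 := m, v2 := m)"] m True in auto)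
    then show ?thesis using in_block by blast
  next
    case False
    obtain p where p: "fst (?\<sigma> p) = v1" using a(2) by (auto simp: loop_vertices_def v1_def)
    obtain q where q: "fst (?\<sigma> q) = v2" using b(2) by (auto simp: loop_vertices_def v2_def)
    have T: "0 < T" using loop by (simp add: winding_loop_def)
    \<comment> \<open>Adding \<open>p\<close> full turns makes the visit to \<open>v2\<close> later
      than the one to \<open>v1\<close>, so that the subtraction is not truncated.\<close>
    have "fst (?\<sigma> (p + (T * p + q - p))) = v2"
    proof -
      have "p \<le> T * p" using T by simp
      then have "p + (T * p + q - p) = q + T * p" by linarith
      then show ?thesis using loop_period[OF n loop, of q p] q by simp
    qed
    then have ex: "\<exists>r p. fst (?\<sigma> p) = v1 \<and> fst (?\<sigma> (p + r)) = v2" using p by blast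
    \<comment> \<open>The loop may visit a vertex more than once. Taking the shortest run from any
      visit to \<open>v1\<close> to any visit to \<open>v2\<close> ensures that neither changed
      mirror is met on the way.\<close>
    define r where "r = (LEAST r. \<exists>p. fst (?\<sigma> p) = v1 \<and> fst (?\<sigma> (p + r)) = v2)"
    obtain s where s: "fst (?\<sigma> s) = v1" "fst (?\<sigma> (s + r)) = v2"
      using LeastI_ex[OF ex] unfolding r_def by blast
    have minimal: "r \<le> r'" if "fst (?\<sigma> p) = v1" "fst (?\<sigma> (p + r')) = v2" for r' p
      unfolding r_def by (rule Least_le) (use that in blast)
    have r0: "r \<noteq> 0" using s False by (metis add_0_right)
    have between: "fst (?\<sigma> (s + j)) \<notin> {v1, v2}" if j: "0 < j" "j < r" for j
    proof
      assume "fst (?\<sigma> (s + j)) \<in> {v1, v2}"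
      then consider "fst (?\<sigma> (s + j)) = v1" | "fst (?\<sigma> (s + j)) = v2" by blast
      then show False
      proof cases
        case 1
        then show False using minimal[of "s + j" "r - j"] s(2) j by simp
      next
        case 2
        then show False using minimal[OF s(1), of j] j by simp
      qed
    qed
    define ds where "ds = snd (?\<sigma> s)"
    obtain r' where r': "r = Suc r'" using r0 not0_implies_Suc by blast
    define dw where "dw = snd (?\<sigma> (s + r'))"
    note on_loop = loop_vertices_step[OF n loop]
    \<comment> \<open>A mirror can pair any two distinct half-edges. Here equality would put the
      vertex before \<open>v1\<close> on the loop, against the choice of \<open>a\<close>; the
      inequality at \<open>v2\<close> is proved in the same way with \<open>b\<close>.\<close>
    have "opposite d1 \<noteq> ds"
    proof
      assume "opposite d1 = ds"
      then have "fst (?\<gamma> a') = ?C (fst (?\<sigma> s)) (snd (?\<sigma> s))"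
        using cylinder_opposite[OF V(1)[of a'], of d1] by (simp add: s(1) v1 ds_def)
      then show False using on_loop(2)[of s] a(3)[of a'] a' by simp
    qed
    then obtain m1 where m1: "paired m1 (opposite d1) = ds" using ex_paired by blast
    have "dw \<noteq> d2"
    proof
      assume "dw = d2"
      have *: "?C (fst (?\<sigma> (s + r'))) dw = v2"
        using s(2) by (simp add: r' trajectory_Suc fst_next_edge dw_def)
      have "fst (?\<sigma> (s + r')) = ?C v2 (opposite dw)"
        using cylinder_opposite[OF loop_in_vertices[OF n loop, of "s + r'"], of dw]
        unfolding * by (rule sym)
      also have "\<dots> = fst (?\<eta> b')"
        unfolding v2 \<open>dw = d2\<close> by (rule cylinder_opposite[OF V(2)])
      finally have "fst (?\<sigma> (s + r')) = fst (?\<eta> b')" .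
      then show False using on_loop(1)[of "s + r'"] b(3)[of b'] b' by simp
    qed
    then obtain m2 where m2: "paired m2 (opposite dw) = opposite d2"
      using ex_paired[of "opposite dw" "opposite d2"] by auto
    define \<omega>' where "\<omega>' = \<omega> (v1 := m1, v2 := m2)"
    have \<omega>': "\<omega>' v = \<omega> v" if "v \<notin> {v1, v2}" for v using that by (simp add: \<omega>'_def)
    have "\<omega>' v1 = m1" using False by (simp add: \<omega>'_def)
    then have "trajectory ?C \<omega>' (entry y1) a = (v1, ds)"
      using arrive[OF \<omega>'] m1 by simp
    also have "\<dots> = ?\<sigma> s" using s(1) by (simp add: ds_def prod_eq_iff)
    finally have at_a: "trajectory ?C \<omega>' (entry y1) a = ?\<sigma> s" .
    have along: "trajectory ?C \<omega>' (entry y1) (a + j) = ?\<sigma> (s + j)" if "j < r" for j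
    proof -
      have "trajectory ?C \<omega>' (?\<sigma> s) j = trajectory ?C \<omega> (?\<sigma> s) j"
        by (rule trajectory_cong) (use between that \<omega>' in \<open>simp flip: trajectory_add\<close>)
      then show ?thesis by (simp add: trajectory_add at_a)
    qed
    have "trajectory ?C \<omega>' (entry y1) (a + r) = (v2, opposite d2)"
      using along[of r'] s(2) m2 by (simp add: r' trajectory_Suc next_edge_def Let_def fst_next_edge \<omega>'_def dw_def)
    then have "y1 \<notin> passing n w' \<omega>'"
    proof (rule conclude[OF \<omega>', rotated 2])
      fix j assume "a \<le> j" "j < a + r"
      then have "trajectory ?C \<omega>' (entry y1) j = ?\<sigma> (s + (j - a))"
        using along[of "j - a"] by simp
      then show "col (trajectory ?C \<omega>' (entry y1) j) \<le> w'"
        using loop_col(2)[OF n loop] by simp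
    qed auto
    then show ?thesis using in_block unfolding \<omega>'_def by blast
  qed
qed

section \<open>Winding loops from crossings\<close>

fun flip_mirror :: "mirror \<Rightarrow> mirror" where
  "flip_mirror NoMirror = NoMirror"
| "flip_mirror NW = NE"
| "flip_mirror NE = NW"

fun vflip :: "dir \<Rightarrow> dir" where
  "vflip North = South"
| "vflip East = East"
| "vflip South = North"
| "vflip West = West"

definition wrap :: "nat \<Rightarrow> int \<Rightarrow> vertex \<Rightarrow> vertex" where
  "wrap n c v = (c + fst v, snd v mod (2 * int n))"

text \<open>The reflection of row y to 1 - y modulo 2n exchanges rows 0 and 1 and rows n and n+1. It
  keeps the entrance and exit edges in place, reversing them, and maps rows 1 to n onto the other
  half.\<close>

definition wrap_flip :: "nat \<Rightarrow> int \<Rightarrow> vertex \<Rightarrow> vertex" where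
  "wrap_flip n c v = (c + fst v, (2 * int n + 1 - snd v) mod (2 * int n))"

lemma trajectory_wrap:
  "trajectory (cylinder n) \<omega> (map_prod (wrap n c) id e) k =
   map_prod (wrap n c) id (trajectory plane (\<omega> \<circ> wrap n c) e k)"
proof -
  have "trajectory (cylinder n) \<omega> (map_prod (wrap n c) id e) k =
     map_prod (wrap n c) id (trajectory plane (id \<circ> \<omega> \<circ> wrap n c) e k)"
  proof (rule trajectory_hom)
    show "cylinder n (wrap n c v) (id d) = wrap n c (plane v d)" for v d
      by (simp add: cylinder_def wrap_def plane_def mod_add_left_eq)
  qed auto
  then show ?thesis by simp
qed

lemma trajectory_wrap_flip:
  "trajectory (cylinder n) \<omega> (map_prod (wrap_flip n c) vflip e) k =
   map_prod (wrap_flip n c) vflip (trajectory plane (flip_mirror \<circ> \<omega> \<circ> wrap_flip n c) e k)"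
proof (rule trajectory_hom)
  show "cylinder n (wrap_flip n c v) (vflip d) = wrap_flip n c (plane v d)" for v d
  proof -
    have "snd (dir_vec (vflip d)) = - snd (dir_vec d)" "fst (dir_vec (vflip d)) = fst (dir_vec d)"
      by (cases d; simp)+
    moreover have "((2 * int n + 1 - snd v) mod (2 * int n) + - snd (dir_vec d)) mod (2 * int n) =
        (2 * int n + 1 - (snd v + snd (dir_vec d))) mod (2 * int n)"
      unfolding mod_add_left_eq by (rule arg_cong[of _ _ "\<lambda>x. x mod (2 * int n)"]) simp
    ultimately show ?thesis by (simp add: cylinder_def wrap_flip_def plane_def)
  qed
  show "opposite (vflip d) = vflip (opposite d)" for d by (cases d) auto
  show "paired m (vflip d) = vflip (paired (flip_mirror m) d)" for m d by (cases m; cases d) auto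
qed

lemma wrap_rectangle:
  assumes "n \<ge> 1" "v \<in> rectangle L n"
  shows "wrap n c v \<in> block n c (c + int L)" "snd (wrap n c v) = snd v"
  using assms by (auto simp: wrap_def rectangle_def block_def)

lemma wrap_flip_rectangle:
  assumes "n \<ge> 1" "v \<in> rectangle L n"
  shows "wrap_flip n c v \<in> block n c (c + int L)"
    and "snd (wrap_flip n c v) = (if snd v = 1 then 0 else 2 * int n + 1 - snd v)"
  using assms by (auto simp: wrap_flip_def rectangle_def block_def)

text \<open>A crossing from column \<open>i\<close> to column \<open>j\<close> in one half of the cylinder and the time reversal of
  a reflected crossing with the same end columns in the other half close up to a loop.\<close>

lemma winding_loop_of_crossings:
  assumes n: "n \<ge> 1" and i: "i \<in> {1..int L}"
    and c1: "cross_at L n i j (\<omega> \<circ> wrap n c)"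
    and c2: "cross_at L n i j (flip_mirror \<circ> \<omega> \<circ> wrap_flip n c)"
  shows "\<exists>e T. winding_loop n c (c + int L) \<omega> e T"
proof -
  let ?C = "cylinder n"
  define e where "e = ((c + i, 0 :: int), North)"
  define f where "f = ((c + i, 1 :: int), South)"
  let ?\<sigma> = "trajectory ?C \<omega> e" and ?\<tau> = "trajectory ?C \<omega> f"
  obtain a where a: "trajectory plane (\<omega> \<circ> wrap n c) ((i, 0), North) a = ((j, int n), North)"
    "\<And>l. 0 < l \<Longrightarrow> l \<le> a \<Longrightarrow> fst (trajectory plane (\<omega> \<circ> wrap n c) ((i, 0), North) l) \<in> rectangle L n"
    using c1 unfolding cross_at_alt[OF n] by blast
  obtain b where b: "trajectory plane (flip_mirror \<circ> \<omega> \<circ> wrap_flip n c) ((i, 0), North) b = ((j, int n), North)"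
    "\<And>l. 0 < l \<Longrightarrow> l \<le> b \<Longrightarrow>
       fst (trajectory plane (flip_mirror \<circ> \<omega> \<circ> wrap_flip n c) ((i, 0), North) l) \<in> rectangle L n"
    using c2 unfolding cross_at_alt[OF n] by blast
  have e: "e = map_prod (wrap n c) id ((i, 0), North)" by (simp add: e_def wrap_def)
  have "(2 * int n + 1) mod (2 * int n) = 1" using n by simp
  then have f: "f = map_prod (wrap_flip n c) vflip ((i, 0), North)"
    by (simp add: f_def wrap_flip_def)
  have V: "fst e \<in> cylinder_vertices n" "fst f \<in> cylinder_vertices n"
    using n by (simp_all add: e_def f_def cylinder_vertices_def)
  have \<sigma>: "fst (?\<sigma> k) \<in> block n c (c + int L)" "snd (fst (?\<sigma> k)) \<noteq> 0" if "0 < k" "k \<le> a" for k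
    using wrap_rectangle[OF n a(2)[OF that]] a(2)[OF that]
    unfolding e trajectory_wrap by (auto simp: rectangle_def)
  have \<tau>: "fst (?\<tau> k) \<in> block n c (c + int L)" "snd (fst (?\<tau> k)) \<noteq> 1" if "0 < k" "k \<le> b" for k
    using wrap_flip_rectangle[OF n b(2)[OF that]] b(2)[OF that]
    unfolding f trajectory_wrap_flip by (auto simp: rectangle_def)
  have \<sigma>a: "?\<sigma> a = ((c + j, int n), North)"
    unfolding e trajectory_wrap a(1) using n by (simp add: wrap_def)
  have \<tau>b: "?\<tau> b = ((c + j, (int n + 1) mod (2 * int n)), South)"
    unfolding f trajectory_wrap_flip b(1) by (simp add: wrap_flip_def)
  \<comment> \<open>The two trajectories traverse the exit edge in opposite directions, so from time
    \<open>a\<close> on \<open>?\<sigma>\<close> retraces \<open>?\<tau>\<close>.\<close>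
  have "rev_edge ?C (?\<tau> b) = ?\<sigma> a"
    using n unfolding \<sigma>a \<tau>b by (simp add: rev_edge_def cylinder_def mod_diff_left_eq)
  then have late: "?\<sigma> (a + l) = rev_edge ?C (?\<tau> (b - l))" if "l \<le> b" for l
    using trajectory_rev_edge[OF n that, of \<omega> f] by (simp add: trajectory_add)
  have late_vertex: "fst (?\<sigma> (a + l)) = fst (?\<tau> (Suc (b - l)))" if "l \<le> b" for l
    by (simp add: late[OF that] rev_edge_def trajectory_Suc fst_next_edge)
  have a0: "0 < a" using a(1) n by (cases a) auto
  have b0: "0 < b" using b(1) n by (cases b) auto
  have closed: "?\<sigma> (a + b) = e"
    using late[of b] n by (simp add: rev_edge_def f_def e_def cylinder_def)
  have cols: "c < col (?\<sigma> k) \<and> col (?\<sigma> k) \<le> c + int L" if k: "k < a + b" for k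
  proof -
    consider "k = 0" | "0 < k" "k \<le> a" | l where "k = a + l" "0 < l" "l < b"
      using k by (metis add_less_cancel_left le_add_diff_inverse nat_less_le not_le zero_less_diff not_gr_zero)
    then show ?thesis
    proof cases
      case 1
      then show ?thesis using i by (simp add: e_def col_def)
    next
      case 2
      then show ?thesis using \<sigma>(1)[of k] by (auto simp: block_def col_def)
    next
      case 3
      then have "fst (?\<sigma> k) \<in> block n c (c + int L)"
        using \<tau>(1)[of "Suc (b - l)"] late_vertex[of l] by simp
      then show ?thesis by (auto simp: block_def col_def)
    qed
  qed
  \<comment> \<open>An edge across the cut has one end in row 0 and one in row 1, while after time 0
    the first crossing stays off row 0 and the second off row 1.\<close>
  have cut: "\<not> (snd (fst (?\<sigma> k)) = 0 \<and> snd (?\<sigma> k) = North) \<and>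
      \<not> (snd (fst (?\<sigma> k)) = 1 \<and> snd (?\<sigma> k) = South)" if k: "0 < k" "k < a + b" for k
  proof -
    consider "k < a" | "k = a" | l where "k = a + l" "0 < l" "l < b"
      using k by (metis add_less_cancel_left le_add_diff_inverse linorder_neqE_nat less_imp_le zero_less_diff)
    then show ?thesis
    proof cases
      case 1
      have "snd (fst (?\<sigma> (Suc k))) = 0" if "snd (fst (?\<sigma> k)) = 1" "snd (?\<sigma> k) = South"
        using that by (simp add: trajectory_Suc fst_next_edge cylinder_def)
      then show ?thesis using 1 \<sigma>(2)[of k] \<sigma>(2)[of "Suc k"] k(1) by auto
    next
      case 2
      then show ?thesis using \<sigma>(2)[of a] a0 \<sigma>a by auto
    next
      case 3
      define m where "m = b - l"
      have m: "0 < m" "m < b" using 3 by (simp_all add: m_def)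
      have \<sigma>k: "?\<sigma> k = (fst (?\<tau> (Suc m)), opposite (snd (?\<tau> m)))"
        using 3 late[of l] by (simp add: m_def rev_edge_def trajectory_Suc fst_next_edge)
      have "snd (fst (?\<tau> m)) = 1" if "snd (fst (?\<tau> (Suc m))) = 0" "snd (?\<tau> m) = South"
      proof -
        have "?C (fst (?\<tau> (Suc m))) North = fst (?\<tau> m)"
          using cylinder_opposite[OF trajectory_in_vertices[OF n V(2)], of \<omega> m South] that(2)
          by (simp add: trajectory_Suc fst_next_edge)
        then have "snd (fst (?\<tau> m)) = snd (?C (fst (?\<tau> (Suc m))) North)" by simp
        then show ?thesis using that(1) n by (simp add: cylinder_def)
      qed
      moreover have "snd (?\<tau> m) = South" if "opposite (snd (?\<tau> m)) = North"
        using that by (cases "snd (?\<tau> m)") auto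
      ultimately show ?thesis
        using \<tau>(2)[of m] \<tau>(2)[of "Suc m"] m unfolding \<sigma>k by auto
    qed
  qed
  have "winding_loop n c (c + int L) \<omega> e (a + b)"
    unfolding winding_loop_def using a0 V(1) closed cols cut by (auto simp: e_def)
  then show ?thesis by blast
qed

section \<open>Finite environments\<close>

text \<open>A discrete law on total environments, with the default \<open>NoMirror\<close> off
  \<open>A\<close>: every event is measurable and events on \<open>env\<close> apply without
  restriction maps.\<close>

definition env_pmf :: "real \<Rightarrow> vertex set \<Rightarrow> env pmf" where
  "env_pmf p A = Pi_pmf A NoMirror (lorentz_site p)"

definition glue :: "vertex set \<Rightarrow> env \<Rightarrow> env \<Rightarrow> env" where
  "glue A f g v = (if v \<in> A then f v else g v)"

lemma lorentz_site_const: "lorentz_site p = (\<lambda>_. lorentz_site p v)"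
  by (simp add: lorentz_site_def fun_eq_iff)

lemma UNIV_mirror: "(UNIV :: mirror set) = {NoMirror, NW, NE}"
  using mirror.exhaust by auto

lemma finite_mirror [simp]: "finite (UNIV :: mirror set)"
  by (simp add: UNIV_mirror)

lemma card_mirror: "card (UNIV :: mirror set) = 3"
  by (simp add: UNIV_mirror)

lemma pmf_lorentz_site:
  assumes "0 \<le> p" "p \<le> 1"
  shows "pmf (lorentz_site p v) m = (if m = NoMirror then 1 - p else p / 2)"
  using assms
  by (cases m) (simp_all add: lorentz_site_def pmf_bind map_pmf_def pmf_return)

text \<open>Both orientations have probability p/2. This symmetry gives a reflected crossing the
  probability of the original one.\<close>

lemma map_flip_lorentz_site:
  assumes "0 \<le> p" "p \<le> 1"
  shows "map_pmf flip_mirror (lorentz_site p v) = lorentz_site p v"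
proof (rule pmf_eqI)
  fix m
  have inj: "inj flip_mirror"
    by (rule inj_on_inverseI[where g = flip_mirror]) (metis flip_mirror.elims flip_mirror.simps)
  have "pmf (map_pmf flip_mirror (lorentz_site p v)) (flip_mirror m') = pmf (lorentz_site p v) (flip_mirror m')" for m'
    using assms by (subst pmf_map_inj'[OF inj]) (cases m'; simp add: pmf_lorentz_site)
  from this[of "flip_mirror m"] show "pmf (map_pmf flip_mirror (lorentz_site p v)) m = pmf (lorentz_site p v) m"
    by (cases m) auto
qed

lemma env_pmf_union:
  assumes "finite A" "finite B" "A \<inter> B = {}"
  shows "env_pmf p (A \<union> B) = map_pmf (\<lambda>(f, g). glue A f g) (pair_pmf (env_pmf p A) (env_pmf p B))"
  unfolding env_pmf_def using Pi_pmf_union[OF assms, of NoMirror "lorentz_site p"]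
  by (simp add: glue_def[abs_def])

lemma prob_env_pmf_subset:
  assumes "finite B" "A \<subseteq> B" "depends_on A E"
  shows "measure_pmf.prob (env_pmf p A) {\<omega>. E \<omega>} = measure_pmf.prob (env_pmf p B) {\<omega>. E \<omega>}"
proof -
  have "E (\<lambda>x. if x \<in> A then f x else NoMirror) = E f" for f
    by (rule depends_onD[OF assms(3)]) simp
  then show ?thesis
    unfolding env_pmf_def Pi_pmf_subset[OF assms(1,2)] measure_map_pmf by (simp add: vimage_def)
qed

lemma prob_env_pmf_reindex:
  assumes B: "finite B" and h: "inj_on h A" "h ` A \<subseteq> B" and E: "depends_on A E"
    and s: "map_pmf s (lorentz_site p (0, 0)) = lorentz_site p (0, 0)" "s NoMirror = NoMirror"
  shows "measure_pmf.prob (env_pmf p B) {\<omega>. E (s \<circ> \<omega> \<circ> h)} = measure_pmf.prob (env_pmf p A) {\<omega>. E \<omega>}"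
proof -
  let ?\<mu> = "lorentz_site p (0, 0)"
  have hA: "finite (h ` A)" using h(2) B by (rule finite_subset)
  then have A: "finite A" using h(1) by (rule finite_imageD)
  obtain z where z: "z \<notin> h ` A" using ex_new_if_finite[OF _ hA] infinite_UNIV_char_0
    by (metis finite_Prod_UNIV finite_prod infinite_UNIV_int)
  \<comment> \<open>Reindexing asks that points off \<open>A\<close> be sent outside the image of
    \<open>A\<close>; the dummy vertex \<open>z\<close> absorbs them.\<close>
  define h' where "h' x = (if x \<in> A then h x else z)" for x
  have bij: "bij_betw h' A (h ` A)"
    using h(1) by (auto simp: bij_betw_def h'_def inj_on_def)
  have "env_pmf p A = Pi_pmf A NoMirror (\<lambda>_. map_pmf s ?\<mu>)"
    unfolding env_pmf_def s(1) by (subst lorentz_site_const[of p "(0, 0)"]) (rule refl)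
  also have "\<dots> = map_pmf (\<lambda>\<omega>. s \<circ> \<omega>) (Pi_pmf A NoMirror (\<lambda>_. ?\<mu>))"
    by (rule Pi_pmf_map[where f = s, OF A s(2)])
  also have "Pi_pmf A NoMirror (\<lambda>_. ?\<mu>) = map_pmf (\<lambda>g. g \<circ> h') (Pi_pmf (h ` A) NoMirror (\<lambda>_. ?\<mu>))"
    by (rule Pi_pmf_bij_betw[OF A bij]) (use z in \<open>simp add: h'_def\<close>)
  also have "Pi_pmf (h ` A) NoMirror (\<lambda>_. ?\<mu>) = env_pmf p (h ` A)"
    unfolding env_pmf_def by (subst (2) lorentz_site_const[of p "(0, 0)"]) (rule refl)
  finally have "measure_pmf.prob (env_pmf p A) {\<omega>. E \<omega>} =
      measure_pmf.prob (env_pmf p (h ` A)) {\<omega>. E (s \<circ> (\<omega> \<circ> h'))}"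
    by (simp add: map_pmf_comp vimage_def o_def)
  also have "{\<omega>. E (s \<circ> (\<omega> \<circ> h'))} = {\<omega>. E (s \<circ> \<omega> \<circ> h)}"
    by (intro Collect_cong depends_onD[OF E]) (simp add: h'_def)
  also have "measure_pmf.prob (env_pmf p (h ` A)) {\<omega>. E (s \<circ> \<omega> \<circ> h)} =
      measure_pmf.prob (env_pmf p B) {\<omega>. E (s \<circ> \<omega> \<circ> h)}"
  proof (rule prob_env_pmf_subset[OF B h(2)])
    show "depends_on (h ` A) (\<lambda>\<omega>. E (s \<circ> \<omega> \<circ> h))"
      by (rule depends_onI) (use depends_onD[OF E] in \<open>smt (verit) comp_apply imageI\<close>)
  qed
  finally show ?thesis ..
qed

lemma prob_pair_pmf_Times:
  "measure_pmf.prob (pair_pmf M N) (A \<times> B) = measure_pmf.prob M A * measure_pmf.prob N B"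
proof -
  have "measure_pmf.prob (pair_pmf M N) (A \<times> B) =
      measure_pmf.prob (pair_pmf M N) ((A \<inter> set_pmf M) \<times> (B \<inter> set_pmf N))"
    by (subst measure_Int_set_pmf[symmetric]) (auto intro!: arg_cong[of _ _ "measure_pmf.prob _"])
  also have "\<dots> = measure_pmf.prob M (A \<inter> set_pmf M) * measure_pmf.prob N (B \<inter> set_pmf N)"
    by (rule measure_pmf_prob_product) (auto intro: countable_Int2)
  finally show ?thesis by (simp add: measure_Int_set_pmf)
qed

lemma prob_env_pmf_indep:
  assumes "finite D" "A \<subseteq> D" "B \<subseteq> D" "A \<inter> B = {}" "depends_on A E" "depends_on B F"
  shows "measure_pmf.prob (env_pmf p D) {\<omega>. E \<omega> \<and> F \<omega>} =
    measure_pmf.prob (env_pmf p D) {\<omega>. E \<omega>} * measure_pmf.prob (env_pmf p D) {\<omega>. F \<omega>}"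
proof -
  have fin: "finite A" "finite (D - A)" using assms finite_subset by auto
  have D: "D = A \<union> (D - A)" using assms(2) by blast
  have "E (glue A f g) = E f" for f g
    by (rule depends_onD[OF assms(5)]) (simp add: glue_def)
  moreover have "F (glue A f g) = F g" for f g
    by (rule depends_onD[OF assms(6)]) (use assms(4) in \<open>auto simp: glue_def\<close>)
  ultimately have "measure_pmf.prob (env_pmf p D) {\<omega>. E \<omega> \<and> F \<omega>} =
      measure_pmf.prob (pair_pmf (env_pmf p A) (env_pmf p (D - A))) ({f. E f} \<times> {g. F g})"
    by (subst D, subst env_pmf_union[OF fin])
      (auto simp: intro!: arg_cong[of _ _ "measure_pmf.prob _"])
  also have "\<dots> = measure_pmf.prob (env_pmf p A) {f. E f} * measure_pmf.prob (env_pmf p (D - A)) {g. F g}"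
    by (rule prob_pair_pmf_Times)
  also have "measure_pmf.prob (env_pmf p A) {f. E f} = measure_pmf.prob (env_pmf p D) {f. E f}"
    by (rule prob_env_pmf_subset[OF assms(1,2,5)])
  also have "measure_pmf.prob (env_pmf p (D - A)) {g. F g} = measure_pmf.prob (env_pmf p D) {g. F g}"
    by (rule prob_env_pmf_subset[OF assms(1) _ depends_on_mono[OF assms(6)]]) (use assms in auto)
  finally show ?thesis .
qed

text \<open>Finite energy: the event on the left ignores the state at \<open>v\<close>, which
  independently equals \<open>m\<close> with probability at least \<open>\<kappa>\<close>, and then
  the environment itself lies in \<open>B\<close>.\<close>

lemma prob_resample:
  assumes "finite A" "v \<in> A" and \<kappa>: "\<And>m. \<kappa> \<le> pmf (lorentz_site p v) m"
  shows "\<kappa> * measure_pmf.prob (env_pmf p A) {\<omega>. \<omega> (v := m) \<in> B} \<le> measure_pmf.prob (env_pmf p A) B"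
proof -
  let ?Q = "env_pmf p (A - {v})"
  have A: "env_pmf p A = map_pmf (\<lambda>(x, f). f(v := x)) (pair_pmf (lorentz_site p v) ?Q)"
    using Pi_pmf_insert[of "A - {v}" v NoMirror "lorentz_site p"] assms
    by (simp add: env_pmf_def insert_absorb)
  have "measure_pmf.prob (env_pmf p A) {\<omega>. \<omega> (v := m) \<in> B} =
      measure_pmf.prob (pair_pmf (lorentz_site p v) ?Q) (UNIV \<times> {f. f(v := m) \<in> B})"
    unfolding A measure_map_pmf by (rule arg_cong[of _ _ "measure_pmf.prob _"]) auto
  also have "\<dots> = measure_pmf.prob ?Q {f. f(v := m) \<in> B}"
    by (simp add: prob_pair_pmf_Times)
  finally have "\<kappa> * measure_pmf.prob (env_pmf p A) {\<omega>. \<omega> (v := m) \<in> B} \<le>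
      pmf (lorentz_site p v) m * measure_pmf.prob ?Q {f. f(v := m) \<in> B}"
    using \<kappa>[of m] by (simp add: mult_right_mono)
  also have "\<dots> = measure_pmf.prob (pair_pmf (lorentz_site p v) ?Q) ({m} \<times> {f. f(v := m) \<in> B})"
    by (simp add: prob_pair_pmf_Times measure_pmf_single)
  also have "\<dots> \<le> measure_pmf.prob (env_pmf p A) B"
    unfolding A measure_map_pmf by (rule measure_pmf.finite_measure_mono) auto
  finally show ?thesis .
qed

text \<open>The place and the kind of the change may depend on the environment; the union bound over
  all vertices and the three states is the price.\<close>

lemma prob_resample_some:
  assumes A: "finite A" and \<kappa>: "0 < \<kappa>" "\<And>v m. \<kappa> \<le> pmf (lorentz_site p v) m"
  shows "measure_pmf.prob (env_pmf p A) {\<omega>. \<exists>v\<in>A. \<exists>m. \<omega> (v := m) \<in> B} \<le>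
    3 * real (card A) / \<kappa> * measure_pmf.prob (env_pmf p A) B"
proof -
  let ?P = "measure_pmf.prob (env_pmf p A)"
  have "{\<omega>. \<exists>v\<in>A. \<exists>m. \<omega> (v := m) \<in> B} = (\<Union>(v, m)\<in>A \<times> UNIV. {\<omega>. \<omega> (v := m) \<in> B})"
    by auto
  also have "?P \<dots> \<le> (\<Sum>(v, m)\<in>A \<times> UNIV. ?P {\<omega>. \<omega> (v := m) \<in> B})"
    using measure_pmf.finite_measure_subadditive_finite[of "A \<times> UNIV" "\<lambda>(v, m). {\<omega>. \<omega> (v := m) \<in> B}"] A
    by (simp add: case_prod_unfold)
  also have "\<dots> \<le> (\<Sum>(v, m :: mirror)\<in>A \<times> UNIV. ?P B / \<kappa>)"
    using prob_resample[OF A _ \<kappa>(2), where B = B] \<kappa>(1)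
    by (intro sum_mono) (auto simp: pos_le_divide_eq mult.commute)
  also have "\<dots> = 3 * real (card A) / \<kappa> * ?P B"
    by (simp add: card_cartesian_product card_mirror)
  finally show ?thesis .
qed

subsection \<open>Finite marginals of infinite environments\<close>

text \<open>Both laws have the same marginal on \<open>A\<close>. The event is the preimage of a set
  of configurations on \<open>A\<close>, and there are finitely many of these, each measurable as a
  product of singletons.\<close>

lemma prob_PiM_env_pmf:
  fixes p :: real
  assumes A: "finite A" "A \<subseteq> I" and E: "depends_on A E"
  defines "P \<equiv> \<Pi>\<^sub>M v\<in>I. measure_pmf (lorentz_site p v)"
  shows "\<P>(\<omega> in P. E \<omega>) = measure_pmf.prob (env_pmf p A) {\<omega>. E \<omega>}"
proof -
  let ?M = "\<lambda>v. measure_pmf (lorentz_site p v)"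
  interpret product_prob_space ?M I by unfold_locales
  let ?PA = "\<Pi>\<^sub>M v\<in>A. ?M v"
  have 1: "distr P ?PA (\<lambda>\<omega>. restrict \<omega> A) = ?PA"
    unfolding P_def by (rule distr_PiM_restrict_finite[OF A])
  have meas1: "(\<lambda>\<omega>. restrict \<omega> A) \<in> measurable P ?PA"
    unfolding P_def by (rule measurable_restrict_subset[OF A(2)])
  have meas2: "(\<lambda>\<omega>. restrict \<omega> A) \<in> measurable (measure_pmf (env_pmf p A)) ?PA"
    by (rule measurable_restrict) simp
  have 2: "distr (measure_pmf (env_pmf p A)) ?PA (\<lambda>\<omega>. restrict \<omega> A) = ?PA"
  proof (rule PiM_eqI)
    fix X assume "\<And>v. v \<in> A \<Longrightarrow> X v \<in> sets (?M v)"
    then have X: "Pi\<^sub>E A X \<in> sets ?PA" using A(1) by (intro sets_PiM_I_finite) auto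
    have "emeasure (distr (measure_pmf (env_pmf p A)) ?PA (\<lambda>\<omega>. restrict \<omega> A)) (Pi\<^sub>E A X) =
        emeasure (measure_pmf (env_pmf p A)) (Pi A X)"
      by (subst emeasure_distr[OF meas2 X]) (auto intro!: arg_cong[of _ _ "emeasure _"])
    also have "\<dots> = (\<Prod>v\<in>A. emeasure (?M v) (X v))"
      using measure_Pi_pmf_Pi[OF A(1), of NoMirror "lorentz_site p" X]
      by (simp add: env_pmf_def measure_pmf.emeasure_eq_measure prod_ennreal)
    finally show "emeasure (distr (measure_pmf (env_pmf p A)) ?PA (\<lambda>\<omega>. restrict \<omega> A)) (Pi\<^sub>E A X) =
        (\<Prod>v\<in>A. emeasure (?M v) (X v))" .
  qed (use A in auto)
  define F where "F = {\<omega> \<in> space ?PA. E \<omega>}"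
  have "{\<omega>} \<in> sets ?PA" if "\<omega> \<in> space ?PA" for \<omega>
  proof -
    have "{\<omega>} = (\<Pi>\<^sub>E v\<in>A. {\<omega> v})"
      using that by (auto simp: space_PiM PiE_iff fun_eq_iff extensional_def) metis
    also have "\<dots> \<in> sets ?PA" using A(1) by (intro sets_PiM_I_finite) auto
    finally show ?thesis .
  qed
  moreover have "finite F"
  proof (rule finite_subset)
    show "F \<subseteq> (\<Pi>\<^sub>E v\<in>A. UNIV)" by (auto simp: F_def space_PiM)
    show "finite (\<Pi>\<^sub>E v\<in>A. (UNIV :: mirror set))" using A(1) by (intro finite_PiE) auto
  qed
  ultimately have F: "F \<in> sets ?PA"
    by (metis (no_types, lifting) F_def UN_singleton mem_Collect_eq sets.finite_UN)
  have E': "E (restrict \<omega> A) = E \<omega>" for \<omega>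
    by (rule depends_onD[OF E]) simp
  have "\<P>(\<omega> in P. E \<omega>) = measure (distr P ?PA (\<lambda>\<omega>. restrict \<omega> A)) F"
    by (subst measure_distr[OF meas1 F])
      (auto intro!: arg_cong[of _ _ "measure _"] simp: F_def E' space_PiM P_def)
  also have "\<dots> = measure (distr (measure_pmf (env_pmf p A)) ?PA (\<lambda>\<omega>. restrict \<omega> A)) F"
    unfolding 1 2 ..
  also have "\<dots> = measure_pmf.prob (env_pmf p A) {\<omega>. E \<omega>}"
    by (subst measure_distr[OF meas2 F])
      (auto intro!: arg_cong[of _ _ "measure _"] simp: F_def E' space_PiM)
  finally show ?thesis .
qed

section \<open>Decrease of the number of passing trajectories\<close>

lemma block_split:
  assumes "a \<le> b" "b \<le> c"
  shows "block n a c = block n a b \<union> block n b c" "block n a b \<inter> block n b c = {}"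
  using assms by (auto simp: block_def)

lemma card_block: "card (block n w (w + int L)) = L * (2 * n)"
  by (simp add: block_def card_cartesian_product nat_mult_distrib)

text \<open>Either a trajectory is already lost in the environment with the loop, or all still pass;
  then evenness supplies a second one and rerouting along the loop removes the first.\<close>

lemma winding_loop_imp_decreasable:
  assumes n: "n \<ge> 1" and w: "0 \<le> w" "w \<le> w'" and ne: "passing n w f \<noteq> {}"
    and loop: "winding_loop n w w' (glue (block n 0 w) f g) e T"
  shows "\<exists>v\<in>block n w w'. \<exists>m. \<exists>v'\<in>block n w w'. \<exists>m'.
    passing n w' (glue (block n 0 w) f (g(v := m, v' := m'))) \<subset> passing n w f"
proof -
  let ?A = "block n 0 w" and ?D = "block n w w'"
  define \<omega> where "\<omega> = glue ?A f g"
  note loop = loop[folded \<omega>_def]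
  have old: "passing n w (glue ?A f h) = passing n w f" for h
    by (rule passing_cong[OF n w(1)]) (simp add: glue_def)
  have new: "passing n w' (glue ?A f h) \<subseteq> passing n w f" for h
    using passing_antimono[OF w(2), of n "glue ?A f h"] old by simp
  have glue_upd: "glue ?A f (g(v := m, v' := m')) = \<omega> (v := m, v' := m')"
    if "v \<in> ?D" "v' \<in> ?D" for v v' m m'
    using that block_split(2)[OF w, of n] by (auto simp: \<omega>_def glue_def fun_eq_iff)
  show ?thesis
  proof (cases "passing n w' \<omega> = passing n w f")
    case True
    obtain y1 where y1: "y1 \<in> passing n w f" using ne by blast
    have "passing n w f \<noteq> {y1}" using card_passing_neq_1[OF n w(1), of f] by auto
    then obtain y2 where y2: "y2 \<in> passing n w f" "y1 \<noteq> y2" using y1 by blast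
    obtain v m v' m' where v: "v \<in> ?D" "v' \<in> ?D" and
      y1': "y1 \<notin> passing n w' (\<omega> (v := m, v' := m'))"
      using two_site_modification[OF n w loop, of y1 y2] y1 y2 True by blast
    have "passing n w' (glue ?A f (g(v := m, v' := m'))) \<subset> passing n w f"
      using new[of "g(v := m, v' := m')"] y1 y1' by (auto simp: glue_upd[OF v])
    then show ?thesis using v by blast
  next
    case False
    obtain v where v: "v \<in> ?D"
      using loop_vertices_subset[OF n loop] loop_vertices_step(1)[OF n loop] by blast
    \<comment> \<open>A vacuous change, so that this case takes the same form as the other.\<close>
    have "passing n w' (glue ?A f (g(v := g v, v := g v))) \<subset> passing n w f"
      using False new[of g] by (auto simp: \<omega>_def)
    then show ?thesis using v by blast
  qed
qed

text \<open>The two crossings live on disjoint halves of the stretch and are equally likely by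
  reflection, hence the square.\<close>

lemma prob_two_crossings:
  assumes n: "n \<ge> 1" and p: "0 \<le> p" "p \<le> 1"
  shows "measure_pmf.prob (env_pmf p (block n w (w + int L)))
      {g. cross_at L n i j (g \<circ> wrap n w) \<and> cross_at L n i j (flip_mirror \<circ> g \<circ> wrap_flip n w)} =
    (measure_pmf.prob (env_pmf p (rectangle L n)) {g. cross_at L n i j g})\<^sup>2"
proof -
  let ?D = "block n w (w + int L)" and ?R = "rectangle L n"
  let ?P = "measure_pmf.prob (env_pmf p ?D)"
  note dep = depends_on_cross_at[OF n, of L i j]
  have sub: "wrap n w ` ?R \<subseteq> ?D" "wrap_flip n w ` ?R \<subseteq> ?D"
    using wrap_rectangle(1)[OF n] wrap_flip_rectangle(1)[OF n] by blast+
  have "wrap n w u \<noteq> wrap_flip n w v" if "u \<in> ?R" "v \<in> ?R" for u v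
  proof
    assume "wrap n w u = wrap_flip n w v"
    then have "snd u = (if snd v = 1 then 0 else 2 * int n + 1 - snd v)"
      using wrap_rectangle(2)[OF n that(1), of w] wrap_flip_rectangle(2)[OF n that(2), of w] by simp
    moreover have "snd u \<in> {1..int n}" "snd v \<in> {1..int n}" using that by (auto simp: rectangle_def)
    ultimately show False by (simp split: if_splits)
  qed
  then have disj: "wrap n w ` ?R \<inter> wrap_flip n w ` ?R = {}" by blast
  have inj: "inj_on (wrap n w) ?R" "inj_on (wrap_flip n w) ?R"
  proof -
    show "inj_on (wrap n w) ?R"
    proof (rule inj_onI)
      fix u v assume uv: "u \<in> ?R" "v \<in> ?R" "wrap n w u = wrap n w v"
      then have "snd u = snd v" using wrap_rectangle(2)[OF n] by metis
      then show "u = v" using uv(3) by (auto simp: wrap_def prod_eq_iff)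
    qed
    show "inj_on (wrap_flip n w) ?R"
    proof (rule inj_onI)
      fix u v assume uv: "u \<in> ?R" "v \<in> ?R" "wrap_flip n w u = wrap_flip n w v"
      then have "(if snd u = 1 then 0 else 2 * int n + 1 - snd u) = (if snd v = 1 then 0 else 2 * int n + 1 - snd v)"
        using wrap_flip_rectangle(2)[OF n] by metis
      then have "snd u = snd v" using uv(1,2) by (auto simp: rectangle_def split: if_splits)
      then show "u = v" using uv(3) by (auto simp: wrap_flip_def prod_eq_iff)
    qed
  qed
  have "?P {g. cross_at L n i j (g \<circ> wrap n w) \<and> cross_at L n i j (flip_mirror \<circ> g \<circ> wrap_flip n w)} =
    ?P {g. cross_at L n i j (g \<circ> wrap n w)} * ?P {g. cross_at L n i j (flip_mirror \<circ> g \<circ> wrap_flip n w)}"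
  proof (rule prob_env_pmf_indep[OF _ sub disj])
    show "depends_on (wrap n w ` ?R) (\<lambda>g. cross_at L n i j (g \<circ> wrap n w))"
      by (rule depends_onI, rule depends_onD[OF dep, THEN iffD1]) auto
    show "depends_on (wrap_flip n w ` ?R) (\<lambda>g. cross_at L n i j (flip_mirror \<circ> g \<circ> wrap_flip n w))"
      by (rule depends_onI, rule depends_onD[OF dep, THEN iffD1]) auto
  qed simp
  also have "?P {g. cross_at L n i j (g \<circ> wrap n w)} = measure_pmf.prob (env_pmf p ?R) {g. cross_at L n i j g}"
    using prob_env_pmf_reindex[OF finite_block inj(1) sub(1) dep, of id p] by simp
  also have "?P {g. cross_at L n i j (flip_mirror \<circ> g \<circ> wrap_flip n w)} =
      measure_pmf.prob (env_pmf p ?R) {g. cross_at L n i j g}"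
    by (rule prob_env_pmf_reindex[OF finite_block inj(2) sub(2) dep map_flip_lorentz_site[OF p]]) simp
  finally show ?thesis unfolding power2_eq_square .
qed

lemma prob_passing_decreases:
  assumes n: "n \<ge> 1" and p: "0 \<le> p" "p \<le> 1" and w: "0 \<le> w" and ne: "passing n w f \<noteq> {}"
    and \<kappa>: "0 < \<kappa>" "\<And>v m. \<kappa> \<le> pmf (lorentz_site p v) m"
    and i: "i \<in> {1..int L}"
    and \<beta>: "0 \<le> \<beta>" "\<beta> \<le> measure_pmf.prob (env_pmf p (rectangle L n)) {g. cross_at L n i j g}"
  shows "(\<kappa> * \<beta> / (6 * real (L * n)))\<^sup>2 \<le> measure_pmf.prob (env_pmf p (block n w (w + int L)))
    {g. passing n (w + int L) (glue (block n 0 w) f g) \<subset> passing n w f}"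
proof -
  let ?D = "block n w (w + int L)"
  let ?P = "measure_pmf.prob (env_pmf p ?D)"
  let ?Red = "{g. passing n (w + int L) (glue (block n 0 w) f g) \<subset> passing n w f}"
  let ?K = "3 * real (card ?D) / \<kappa>"
  let ?Loop = "{g. cross_at L n i j (g \<circ> wrap n w) \<and> cross_at L n i j (flip_mirror \<circ> g \<circ> wrap_flip n w)}"
  have K: "0 < ?K" using n i \<kappa>(1) by (simp add: card_block)
  have "?Loop \<subseteq> {g. \<exists>v\<in>?D. \<exists>m. g(v := m) \<in> {g. \<exists>v\<in>?D. \<exists>m. g(v := m) \<in> ?Red}}"
  proof
    fix g assume g: "g \<in> ?Loop"
    let ?\<omega> = "glue (block n 0 w) f g"
    have out: "v \<notin> block n 0 w" if "v \<in> ?D" for v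
      using that by (auto simp: block_def)
    have "cross_at L n i j (?\<omega> \<circ> wrap n w)" "cross_at L n i j (flip_mirror \<circ> ?\<omega> \<circ> wrap_flip n w)"
      using g depends_onD[OF depends_on_cross_at[OF n, of L i j], of "?\<omega> \<circ> wrap n w" "g \<circ> wrap n w"]
        depends_onD[OF depends_on_cross_at[OF n, of L i j],
          of "flip_mirror \<circ> ?\<omega> \<circ> wrap_flip n w" "flip_mirror \<circ> g \<circ> wrap_flip n w"]
        out wrap_rectangle(1)[OF n] wrap_flip_rectangle(1)[OF n]
      by (auto simp: glue_def)
    then obtain e T where "winding_loop n w (w + int L) ?\<omega> e T"
      using winding_loop_of_crossings[OF n i] by blast
    from winding_loop_imp_decreasable[OF n w _ ne this]
    show "g \<in> {g. \<exists>v\<in>?D. \<exists>m. g(v := m) \<in> {g. \<exists>v\<in>?D. \<exists>m. g(v := m) \<in> ?Red}}"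
      by auto
  qed
  then have "?P ?Loop \<le> ?P {g. \<exists>v\<in>?D. \<exists>m. g(v := m) \<in> {g. \<exists>v\<in>?D. \<exists>m. g(v := m) \<in> ?Red}}"
    by (intro measure_pmf.finite_measure_mono) auto
  also have "\<dots> \<le> ?K * ?P {g. \<exists>v\<in>?D. \<exists>m. g(v := m) \<in> ?Red}"
    by (rule prob_resample_some[OF _ \<kappa>]) simp
  also have "\<dots> \<le> ?K * (?K * ?P ?Red)"
    using K by (intro mult_left_mono prob_resample_some[OF _ \<kappa>]) auto
  finally have "?P ?Loop \<le> ?K\<^sup>2 * ?P ?Red" by (simp add: power2_eq_square)
  moreover have "\<beta>\<^sup>2 \<le> ?P ?Loop"
    unfolding prob_two_crossings[OF n p] using \<beta> by (intro power_mono)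
  ultimately have "\<beta>\<^sup>2 \<le> ?P ?Red * ?K\<^sup>2" by (simp only: mult.commute)
  then have "\<beta>\<^sup>2 / ?K\<^sup>2 \<le> ?P ?Red"
    unfolding pos_divide_le_eq[OF zero_less_power[OF K]] .
  moreover have "\<kappa> * \<beta> / (6 * real (L * n)) = \<beta> / ?K"
    by (simp add: card_block)
  ultimately show ?thesis by (simp only: power_divide)
qed

text \<open>Doubling makes any decrease of the count at least halve the weight; the value 0 at 0
  lets the expectation tend to zero once nothing passes.\<close>

definition potential :: "nat \<Rightarrow> real" where
  "potential k = (if k = 0 then 0 else 2 ^ k)"

lemma potential_nonneg: "0 \<le> potential k"
  by (simp add: potential_def)

lemma potential_mono: "j \<le> k \<Longrightarrow> potential j \<le> potential k"
  by (auto simp: potential_def)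

lemma potential_less:
  assumes "j < k" shows "potential j \<le> potential k / 2"
proof -
  obtain k' where "k = Suc k'" "j \<le> k'" using assms by (cases k) auto
  then show ?thesis by (auto simp: potential_def)
qed

text \<open>Given the past, the potential at least halves with probability at least \<open>q\<close>
  and never grows, which yields the factor 1 - q + q/2 per stretch. At width 0 at most 2n entries
  count, hence the weight 2^(2n).\<close>

lemma expected_potential_le:
  fixes L :: nat
  defines "width \<equiv> \<lambda>N. int N * int L"
  assumes n: "n \<ge> 1" and q: "0 \<le> q" "q \<le> 1"
    and dec: "\<And>w f. 0 \<le> w \<Longrightarrow> passing n w f \<noteq> {} \<Longrightarrow>
      q \<le> measure_pmf.prob (env_pmf p (block n w (w + int L)))
        {g. passing n (w + int L) (glue (block n 0 w) f g) \<subset> passing n w f}"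
  shows "(\<integral>\<^sup>+\<omega>. ennreal (potential (card (passing n (width N) \<omega>))) \<partial>env_pmf p (block n 0 (width N)))
    \<le> ennreal ((1 - q / 2) ^ N * 4 ^ n)"
proof (induction N)
  case 0
  have "potential (card (passing n (width 0) \<omega>)) \<le> 4 ^ n" for \<omega>
  proof -
    have "potential (card (passing n (width 0) \<omega>)) \<le> potential (2 * n)"
      by (intro potential_mono card_passing_le)
    also have "\<dots> \<le> 4 ^ n" by (simp add: potential_def power_mult)
    finally show ?thesis .
  qed
  then have "(\<integral>\<^sup>+\<omega>. ennreal (potential (card (passing n (width 0) \<omega>))) \<partial>env_pmf p (block n 0 (width 0)))
      \<le> (\<integral>\<^sup>+\<omega>. ennreal (4 ^ n) \<partial>env_pmf p (block n 0 (width 0)))"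
    by (intro nn_integral_mono ennreal_leI)
  also have "\<dots> = ennreal (4 ^ n)" by simp
  finally show ?case by simp
next
  case (Suc N)
  let ?w = "width N"
  let ?A = "block n 0 ?w" and ?D = "block n ?w (?w + int L)"
  have w: "0 \<le> ?w" "width (Suc N) = ?w + int L" by (simp_all add: width_def algebra_simps)
  have split: "block n 0 (?w + int L) = ?A \<union> ?D" "?A \<inter> ?D = {}"
    using block_split[of 0 ?w "?w + int L" n] w(1) by simp_all
  have inner: "(\<integral>\<^sup>+g. ennreal (potential (card (passing n (?w + int L) (glue ?A f g)))) \<partial>env_pmf p ?D)
      \<le> ennreal (1 - q / 2) * ennreal (potential (card (passing n ?w f)))" for f
  proof -
    let ?S = "passing n ?w f"
    let ?Red = "{g. passing n (?w + int L) (glue ?A f g) \<subset> ?S}"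
    have sub: "passing n (?w + int L) (glue ?A f g) \<subseteq> ?S" for g
    proof -
      have "passing n (?w + int L) (glue ?A f g) \<subseteq> passing n ?w (glue ?A f g)"
        by (rule passing_antimono) simp
      also have "\<dots> = ?S" by (rule passing_cong[OF n w(1)]) (simp add: glue_def)
      finally show ?thesis .
    qed
    have point: "potential (card (passing n (?w + int L) (glue ?A f g))) \<le>
        potential (card ?S) * (1 - indicator ?Red g / 2)" for g
    proof (cases "g \<in> ?Red")
      case True
      then have "card (passing n (?w + int L) (glue ?A f g)) < card ?S"
        by (intro psubset_card_mono) auto
      from potential_less[OF this] show ?thesis using True by simp
    next
      case False
      have "card (passing n (?w + int L) (glue ?A f g)) \<le> card ?S"
        using sub by (intro card_mono) auto
      from potential_mono[OF this] show ?thesis using False by simp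
    qed
    have int: "integrable (env_pmf p ?D) (\<lambda>g. indicator ?Red g :: real)"
      by (rule measure_pmf.integrable_const_bound[where B = 1]) auto
    have "(\<integral>\<^sup>+g. ennreal (potential (card (passing n (?w + int L) (glue ?A f g)))) \<partial>env_pmf p ?D)
        \<le> (\<integral>\<^sup>+g. ennreal (potential (card ?S) * (1 - indicator ?Red g / 2)) \<partial>env_pmf p ?D)"
      by (intro nn_integral_mono ennreal_leI point)
    also have "\<dots> = ennreal (measure_pmf.expectation (env_pmf p ?D) (\<lambda>g. potential (card ?S) * (1 - indicator ?Red g / 2)))"
      by (rule nn_integral_eq_integral)
        (use int in \<open>auto intro!: integrable_mult_right Bochner_Integration.integrable_diff integrable_divide AE_I2 mult_nonneg_nonneg potential_nonneg simp: indicator_def\<close>)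
    also have "measure_pmf.expectation (env_pmf p ?D) (\<lambda>g. potential (card ?S) * (1 - indicator ?Red g / 2)) =
        potential (card ?S) * (1 - measure_pmf.prob (env_pmf p ?D) ?Red / 2)"
      using int by (simp add: Bochner_Integration.integral_diff)
    also have "\<dots> \<le> potential (card ?S) * (1 - q / 2)"
    proof (cases "?S = {}")
      case True
      then show ?thesis by (simp add: potential_def)
    next
      case False
      from dec[OF w(1) this] show ?thesis
        by (intro mult_left_mono potential_nonneg) simp
    qed
    finally show ?thesis using q by (simp add: ennreal_mult'' potential_nonneg mult.commute ennreal_leI)
  qed
  have "(\<integral>\<^sup>+\<omega>. ennreal (potential (card (passing n (width (Suc N)) \<omega>))) \<partial>env_pmf p (block n 0 (width (Suc N))))
      = (\<integral>\<^sup>+f. (\<integral>\<^sup>+g. ennreal (potential (card (passing n (?w + int L) (glue ?A f g)))) \<partial>env_pmf p ?D) \<partial>env_pmf p ?A)"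
    unfolding w(2) split(1) env_pmf_union[OF finite_block finite_block split(2)]
    by (simp add: nn_integral_pair_pmf')
  also have "\<dots> \<le> (\<integral>\<^sup>+f. ennreal (1 - q / 2) * ennreal (potential (card (passing n ?w f))) \<partial>env_pmf p ?A)"
    by (intro nn_integral_mono inner)
  also have "\<dots> = ennreal (1 - q / 2) * (\<integral>\<^sup>+f. ennreal (potential (card (passing n ?w f))) \<partial>env_pmf p ?A)"
    by (rule nn_integral_cmult) simp
  also have "\<dots> \<le> ennreal (1 - q / 2) * ennreal ((1 - q / 2) ^ N * 4 ^ n)"
    by (intro mult_left_mono Suc) simp
  also have "\<dots> = ennreal ((1 - q / 2) ^ Suc N * 4 ^ n)"
    using q by (simp flip: ennreal_mult' add: mult.assoc)
  finally show ?case .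
qed

text \<open>Markov's inequality: the potential is at least 1 as soon as something passes.\<close>

lemma prob_passing_le:
  fixes L N :: nat
  defines "W \<equiv> int N * int L"
  assumes n: "n \<ge> 1" and q: "0 \<le> q" "q \<le> 1"
    and dec: "\<And>w f. 0 \<le> w \<Longrightarrow> passing n w f \<noteq> {} \<Longrightarrow>
      q \<le> measure_pmf.prob (env_pmf p (block n w (w + int L)))
        {g. passing n (w + int L) (glue (block n 0 w) f g) \<subset> passing n w f}"
  shows "measure_pmf.prob (env_pmf p (block n 0 W)) {\<omega>. passing n W \<omega> \<noteq> {}} \<le> (1 - q / 2) ^ N * 4 ^ n"
proof -
  let ?E = "env_pmf p (block n 0 W)"
  have "ennreal (measure_pmf.prob ?E {\<omega>. passing n W \<omega> \<noteq> {}}) =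
      (\<integral>\<^sup>+\<omega>. indicator {\<omega>. passing n W \<omega> \<noteq> {}} \<omega> \<partial>?E)"
    by (simp add: measure_pmf.emeasure_eq_measure)
  also have "\<dots> \<le> (\<integral>\<^sup>+\<omega>. ennreal (potential (card (passing n W \<omega>))) \<partial>?E)"
    by (intro nn_integral_mono) (auto simp: indicator_def potential_def simp flip: ennreal_1 intro!: ennreal_leI)
  also have "\<dots> \<le> ennreal ((1 - q / 2) ^ N * 4 ^ n)"
    unfolding W_def by (rule expected_potential_le[OF n q dec])
  finally show ?thesis using q by (subst (asm) ennreal_le_iff) auto
qed

section \<open>Localization\<close>

fun hflip :: "dir \<Rightarrow> dir" where
  "hflip North = North"
| "hflip East = West"
| "hflip South = South"
| "hflip West = East"

definition mirror_image :: "vertex \<Rightarrow> vertex" where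
  "mirror_image v = (- fst v, snd v)"

lemma trajectory_mirror_image:
  "trajectory (cylinder n) \<omega> (map_prod mirror_image hflip e) k =
   map_prod mirror_image hflip (trajectory (cylinder n) (flip_mirror \<circ> \<omega> \<circ> mirror_image) e k)"
proof (rule trajectory_hom)
  show "cylinder n (mirror_image v) (hflip d) = mirror_image (cylinder n v d)" for v d
    by (cases d) (simp_all add: cylinder_def mirror_image_def)
  show "opposite (hflip d) = hflip (opposite d)" for d by (cases d) auto
  show "paired m (hflip d) = hflip (paired (flip_mirror m) d)" for m d by (cases m; cases d) auto
qed

text \<open>Otherwise cut at the last visit to columns \<le> 0 before time \<open>k\<close>. The
  edge there is an entry edge, and what follows stays in columns \<ge> 1 until it exceeds
  \<open>w\<close>, so it passes.\<close>

lemma col_le_if_none_passing: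
  assumes n: "n \<ge> 1" and w: "0 \<le> w" and none: "passing n w \<omega> = {}"
    and e: "fst e \<in> cylinder_vertices n" "col e \<le> 0"
  shows "col (trajectory (cylinder n) \<omega> e k) \<le> w"
proof (rule ccontr)
  let ?t = "trajectory (cylinder n) \<omega> e"
  assume far: "\<not> col (?t k) \<le> w"
  let ?Z = "{l. l \<le> k \<and> col (?t l) \<le> 0}"
  define l where "l = Max ?Z"
  have Z: "finite ?Z" "?Z \<noteq> {}" using e(2) by (auto intro: exI[of _ 0])
  have l: "l \<le> k" "col (?t l) \<le> 0" using Max_in[OF Z] unfolding l_def by auto
  have after: "1 \<le> col (?t j)" if "l < j" "j \<le> k" for j
  proof (rule ccontr)
    assume "\<not> ?thesis"
    then have "j \<in> ?Z" using that by simp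
    then have "j \<le> l" unfolding l_def using Z(1) by (intro Max_ge)
    then show False using that by simp
  qed
  have lk: "l < k" using l far w by (cases "l = k") auto
  have "col (?t (Suc l)) = col (?t l) + fst (dir_vec (snd (?t l)))"
    by (simp add: trajectory_Suc col_next_edge)
  then have "snd (?t l) = East \<and> col (?t l) = 0"
    using after[of "Suc l"] l(2) lk by (cases "snd (?t l)") simp_all
  then have entry: "?t l = entry (snd (fst (?t l)))"
    by (simp add: entry_def col_def prod_eq_iff)
  have y: "snd (fst (?t l)) \<in> {0..<2 * int n}"
    using trajectory_in_vertices[OF n e(1), of \<omega> l] by (simp add: cylinder_vertices_def mem_Times_iff)
  have shift: "trajectory (cylinder n) \<omega> (entry (snd (fst (?t l)))) j = ?t (l + j)" for j
    unfolding trajectory_add entry[symmetric] ..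
  have "passes n w \<omega> (snd (fst (?t l)))"
    unfolding passes_def shift using far lk after by (intro exI[of _ "k - l"]) auto
  then show False using none y by (auto simp: passing_def)
qed

text \<open>The reflection fixes column 0, so an upper bound on columns in the reflected environment
  is a lower bound in the original one.\<close>

lemma localized_if_none_passing:
  assumes n: "n \<ge> 1" and w: "0 \<le> w" "real_of_int w \<le> M"
    and right: "passing n w \<omega> = {}" and left: "passing n w (flip_mirror \<circ> \<omega> \<circ> mirror_image) = {}"
  shows "localized n M \<omega>"
  unfolding localized_def remains_in_def
proof (intro allI impI)
  fix u :: vertex and d k
  assume u: "u \<in> {0} \<times> {0..<2 * int n}"
  let ?t = "trajectory (cylinder n) \<omega> (u, d)"
  have V: "fst (u, d) \<in> cylinder_vertices n" "fst (u, hflip d) \<in> cylinder_vertices n"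
    and u0: "col (u, d) \<le> 0" "col (u, hflip d) \<le> 0"
    using u by (auto simp: cylinder_vertices_def col_def)
  have "map_prod mirror_image hflip (u, hflip d) = (u, d)"
    using u by (cases d) (auto simp: mirror_image_def)
  then have "col (?t k) = - col (trajectory (cylinder n) (flip_mirror \<circ> \<omega> \<circ> mirror_image) (u, hflip d) k)"
    using trajectory_mirror_image[of n \<omega> "(u, hflip d)" k] by (simp add: col_def mirror_image_def)
  then have "- w \<le> col (?t k)"
    using col_le_if_none_passing[OF n w(1) left V(2) u0(2), of k] by simp
  moreover have "col (?t k) \<le> w" by (rule col_le_if_none_passing[OF n w(1) right V(1) u0(1)])
  ultimately have "\<bar>col (?t k)\<bar> \<le> w" by simp
  then have "real_of_int \<bar>col (?t k)\<bar> \<le> M" using w(2) by linarith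
  then show "fst (?t k) \<in> {v \<in> cylinder_vertices n. \<bar>real_of_int (fst v)\<bar> \<le> M}"
    using trajectory_in_vertices[OF n V(1)] by (simp add: col_def)
qed

text \<open>Infinitely many steps are constrained, yet localized trajectories never look outside the
  set, so they are the same in any environment that agrees on it.\<close>

lemma depends_on_localized:
  "depends_on {v \<in> cylinder_vertices n. \<bar>real_of_int (fst v)\<bar> \<le> M} (localized n M)"
    (is "depends_on ?F _")
proof (rule depends_onI)
  fix \<omega> \<omega>' :: env
  assume eq: "\<And>v. v \<in> ?F \<Longrightarrow> \<omega> v = \<omega>' v" and loc: "localized n M \<omega>"
  show "localized n M \<omega>'"
    unfolding localized_def remains_in_def
  proof (intro allI impI)
    fix u :: vertex and d k
    assume u: "u \<in> {0} \<times> {0..<2 * int n}"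
    have inside: "fst (trajectory (cylinder n) \<omega> (u, d) j) \<in> ?F" for j
      using loc u unfolding localized_def remains_in_def by blast
    have "trajectory (cylinder n) \<omega>' (u, d) k = trajectory (cylinder n) \<omega> (u, d) k"
      by (rule trajectory_cong) (rule eq[symmetric], rule inside)
    then show "fst (trajectory (cylinder n) \<omega>' (u, d) k) \<in> ?F" using inside by simp
  qed
qed

text \<open>Failure requires a passing trajectory on the right or, after reflection, on the left.
  Both have the same probability, whence the factor 2.\<close>

lemma prob_localized_ge:
  fixes L N :: nat
  assumes n: "n \<ge> 1" and p: "0 \<le> p" "p \<le> 1" and M: "real (N * L) \<le> M" and q: "0 \<le> q" "q \<le> 1"
    and dec: "\<And>w f. 0 \<le> w \<Longrightarrow> passing n w f \<noteq> {} \<Longrightarrow>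
      q \<le> measure_pmf.prob (env_pmf p (block n w (w + int L)))
        {g. passing n (w + int L) (glue (block n 0 w) f g) \<subset> passing n w f}"
  shows "1 - 2 * ((1 - q / 2) ^ N * 4 ^ n) \<le> \<P>(\<omega> in lorentz_cylinder n p. localized n M \<omega>)"
proof -
  let ?F = "{v \<in> cylinder_vertices n. \<bar>real_of_int (fst v)\<bar> \<le> M}"
  define W where "W = int N * int L"
  let ?A = "block n 0 W"
  let ?P = "measure_pmf.prob (env_pmf p ?F)"
  let ?R = "{\<omega>. passing n W \<omega> \<noteq> {}}"
  let ?R' = "{\<omega>. passing n W (flip_mirror \<circ> \<omega> \<circ> mirror_image) \<noteq> {}}"
  have W: "0 \<le> W" "real_of_int W \<le> M" using M by (simp_all add: W_def)
  have "?F \<subseteq> block n (- \<lfloor>M\<rfloor> - 1) \<lfloor>M\<rfloor>"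
    by (auto simp: block_def cylinder_vertices_def abs_le_iff le_floor_iff) linarith
  then have F: "finite ?F" by (rule finite_subset) simp
  have sub: "?A \<subseteq> ?F" "mirror_image ` ?A \<subseteq> ?F"
    using W by (auto simp: block_def cylinder_vertices_def mirror_image_def)
  have inj: "inj_on mirror_image ?A" by (auto simp: inj_on_def mirror_image_def prod_eq_iff)
  have dep: "depends_on ?A (\<lambda>\<omega>. passing n W \<omega> \<noteq> {})"
    by (rule depends_onI) (use passing_cong[OF n W(1)] in metis)
  have "?P ?R = measure_pmf.prob (env_pmf p ?A) ?R"
    by (rule prob_env_pmf_subset[OF F sub(1) dep, symmetric])
  moreover have "?P ?R' = measure_pmf.prob (env_pmf p ?A) ?R"
    by (rule prob_env_pmf_reindex[OF F inj sub(2) dep map_flip_lorentz_site[OF p]]) simp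
  moreover have "measure_pmf.prob (env_pmf p ?A) ?R \<le> (1 - q / 2) ^ N * 4 ^ n"
    unfolding W_def by (rule prob_passing_le[OF n q dec])
  moreover have "1 \<le> ?P {\<omega>. localized n M \<omega>} + (?P ?R + ?P ?R')"
  proof -
    have "UNIV = {\<omega>. localized n M \<omega>} \<union> (?R \<union> ?R')"
      using localized_if_none_passing[OF n W] by auto
    then have "1 = ?P ({\<omega>. localized n M \<omega>} \<union> (?R \<union> ?R'))"
      by (metis measure_pmf.prob_space space_measure_pmf)
    also have "\<dots> \<le> ?P {\<omega>. localized n M \<omega>} + ?P (?R \<union> ?R')"
      by (rule measure_Un_le) auto
    also have "?P (?R \<union> ?R') \<le> ?P ?R + ?P ?R'"
      by (rule measure_Un_le) auto
    finally show ?thesis by simp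
  qed
  moreover have "\<P>(\<omega> in lorentz_cylinder n p. localized n M \<omega>) = ?P {\<omega>. localized n M \<omega>}"
    unfolding lorentz_cylinder_def by (rule prob_PiM_env_pmf[OF F _ depends_on_localized]) auto
  ultimately show ?thesis by simp
qed

section \<open>Choice of the constants and conclusion\<close>

lemma ex_likely_crossing:
  assumes n: "n \<ge> 1" and L: "L \<ge> 1" and c: "c \<le> \<P>(\<omega> in lorentz_plane p. cross L n \<omega>)"
  obtains i j where "i \<in> {1..int L}"
    "c / (real L)\<^sup>2 \<le> measure_pmf.prob (env_pmf p (rectangle L n)) {\<omega>. cross_at L n i j \<omega>}"
proof -
  let ?P = "measure_pmf.prob (env_pmf p (rectangle L n))"
  let ?I = "{1..int L} \<times> {1..int L}"
  have "\<exists>x\<in>?I. c / (real L)\<^sup>2 \<le> ?P {\<omega>. cross_at L n (fst x) (snd x) \<omega>}"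
  proof (rule ccontr)
    assume "\<not> ?thesis"
    then have less: "?P {\<omega>. cross_at L n (fst x) (snd x) \<omega>} < c / (real L)\<^sup>2" if "x \<in> ?I" for x
      using that by force
    have "\<P>(\<omega> in lorentz_plane p. cross L n \<omega>) = ?P {\<omega>. cross L n \<omega>}"
      unfolding lorentz_plane_def by (rule prob_PiM_env_pmf[OF _ _ depends_on_cross[OF n]]) auto
    also have "{\<omega>. cross L n \<omega>} = (\<Union>x\<in>?I. {\<omega>. cross_at L n (fst x) (snd x) \<omega>})"
      unfolding cross_def by fastforce
    also have "?P \<dots> \<le> (\<Sum>x\<in>?I. ?P {\<omega>. cross_at L n (fst x) (snd x) \<omega>})"
      by (rule measure_pmf.finite_measure_subadditive_finite) auto
    also have "\<dots> < (\<Sum>x\<in>?I. c / (real L)\<^sup>2)"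
      by (rule sum_strict_mono) (use less L in auto)
    also have "\<dots> = c" using L by (simp add: card_cartesian_product power2_eq_square)
    finally show False using c by simp
  qed
  then show thesis using that by auto
qed

text \<open>The summand 200 in \<open>C\<close> gives M / (100 n) \<ge> 2, so rounding down costs at
  most a factor 2. With t = M / n^9 the decay is exp(-K t / 400), and 1600 / K makes the exponent
  2n, which bounds 4^n, at most half of it.\<close>

lemma power_decay_le_exp:
  fixes K M :: real and n :: nat
  defines "C \<equiv> 1600 / K + 200" and "N \<equiv> nat \<lfloor>M / (100 * real n)\<rfloor>"
  assumes K: "0 < K" "K \<le> 1" and n: "n \<ge> 1" and M: "C * real n ^ 10 \<le> M"
  shows "(1 - K / real n ^ 8 / 2) ^ N * 4 ^ n \<le> exp (- M / (C * real n ^ 10))"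
proof -
  define r where "r = real n"
  define t where "t = M / r ^ 9"
  have r: "1 \<le> r" using n by (simp add: r_def)
  have "0 < 1600 / K" using K by simp
  then have C: "200 \<le> C" "1600 / K \<le> C" "0 < C" unfolding C_def by linarith+
  have t: "C * r \<le> t"
    using M r by (simp add: t_def r_def field_simps eval_nat_numeral)
  have Mt: "M = t * r ^ 9" using r by (simp add: t_def)
  have t0: "0 \<le> t" using t C r by (meson mult_nonneg_nonneg order_trans less_imp_le zero_le_one)
  have "r * 1 \<le> r * r ^ 9" using r by (intro mult_left_mono one_le_power) auto
  have "200 * r \<le> C * r ^ 10"
    using C(1) r \<open>r * 1 \<le> r * r ^ 9\<close> by (intro mult_mono) (simp_all add: eval_nat_numeral)
  then have "200 * r \<le> M" using M by (simp add: r_def)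
  then have "2 \<le> M / (100 * r)" using r by (simp add: field_simps)
  then have N: "M / (200 * r) \<le> real N"
    unfolding N_def r_def[symmetric] by (simp add: field_simps) linarith
  define x where "x = K / r ^ 8 / 2"
  have x: "0 \<le> x" "x \<le> 1"
  proof -
    have "1 \<le> r ^ 8" using r by (rule one_le_power)
    then have "K \<le> 2 * r ^ 8" using K by linarith
    then show "0 \<le> x" "x \<le> 1" using K r by (simp_all add: x_def field_simps)
  qed
  have "(1 - x) ^ N \<le> exp (- x) ^ N"
    using x exp_ge_add_one_self[of "- x"] by (intro power_mono) auto
  also have "\<dots> = exp (- (x * real N))" by (simp flip: exp_of_nat_mult add: mult.commute)
  also have "\<dots> \<le> exp (- (x * (M / (200 * r))))"
    using mult_left_mono[OF N x(1)] by simp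
  also have "x * (M / (200 * r)) = K * t / 400"
    using r by (simp add: x_def Mt field_simps eval_nat_numeral)
  finally have 1: "(1 - x) ^ N \<le> exp (- (K * t / 400))" .
  have "(4 :: real) \<le> exp 1 ^ 2"
    using exp_ge_add_one_self[of 1] power_mono[of 2 "exp 1 :: real" 2] by simp
  then have "(4 :: real) ^ n \<le> (exp 1 ^ 2) ^ n" by (intro power_mono) auto
  also have "\<dots> = exp (2 * r)"
    by (simp add: r_def flip: exp_of_nat_mult power_mult)
  finally have 2: "(4 :: real) ^ n \<le> exp (2 * r)" .
  have "(1 - x) ^ N * 4 ^ n \<le> exp (- (K * t / 400)) * exp (2 * r)"
    using 1 2 by (intro mult_mono) auto
  also have "\<dots> = exp (2 * r - K * t / 400)" by (simp flip: exp_add)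
  also have "\<dots> \<le> exp (- M / (C * r ^ 10))"
  proof -
    have "1600 * r \<le> K * (C * r)"
      using C(2) K(1) r by (simp add: field_simps)
    also have "\<dots> \<le> K * t" using t K by (intro mult_left_mono) auto
    finally have a: "2 * r \<le> K * t / 800" by simp
    have "M / (C * r ^ 10) = t / (C * r)"
      using r C by (simp add: Mt field_simps eval_nat_numeral)
    also have "\<dots> \<le> t / C"
      using r C t0 by (intro divide_left_mono) auto
    also have "\<dots> \<le> t / (1600 / K)"
      using C K t0 by (intro divide_left_mono) auto
    also have "\<dots> = K * t / 1600" by simp
    also have "\<dots> \<le> K * t / 800" using K t0 by simp
    finally have "2 * r - K * t / 400 \<le> - (M / (C * r ^ 10))" using a by linarith
    then show ?thesis by simp
  qed
  finally show ?thesis by (simp add: x_def r_def)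
qed

theorem theorem1p1:
  fixes c0 p :: real
  assumes "admissible c0"
    and "0 < p" and "p < 1"
  shows "\<exists>C>0. \<exists>n_star::nat. \<forall>n::nat.
           n \<ge> 1 \<longrightarrow> n \<ge> n_star \<longrightarrow>
           \<P>(\<omega> in lorentz_plane p. cross (100 * n) n \<omega>) \<ge> c0 \<longrightarrow>
           (\<forall>M::real. M \<ge> C * real n ^ 10 \<longrightarrow>
              \<P>(\<omega> in lorentz_cylinder n p. localized n M \<omega>)
                \<ge> 1 - C * exp (- M / (C * real n ^ 10)))"
proof -
  have c0: "0 < c0" using assms(1) by (simp add: admissible_def)
  define \<kappa> where "\<kappa> = min (p / 2) (1 - p)"
  have \<kappa>: "0 < \<kappa>" "\<kappa> \<le> 1" "\<And>v m. \<kappa> \<le> pmf (lorentz_site p v) m"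
    using assms(2,3) by (auto simp: \<kappa>_def pmf_lorentz_site min_def field_simps)
  \<comment> \<open>Here 6000000 = 6 * 100 * 100^2: the 6 and one 100 come from the cost of a change
    at L = 100 n, the 100^2 from the pairs of end columns. All powers of n collect in
    \<open>q\<close>.\<close>
  define K where "K = (\<kappa> * c0 / 6000000)\<^sup>2"
  define C where "C = 1600 / K + 200"
  have K: "0 < K" using \<kappa> c0 by (simp add: K_def)
  have C: "0 < C" "2 \<le> C" using K by (simp_all add: C_def add_pos_pos)
  have main: "1 - C * exp (- M / (C * real n ^ 10)) \<le> \<P>(\<omega> in lorentz_cylinder n p. localized n M \<omega>)"
    if n: "n \<ge> 1" and cross: "c0 \<le> \<P>(\<omega> in lorentz_plane p. cross (100 * n) n \<omega>)"
      and M: "C * real n ^ 10 \<le> M" for n :: nat and M :: real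
  proof -
    let ?L = "100 * n"
    define q where "q = K / real n ^ 8"
    define N where "N = nat \<lfloor>M / (100 * real n)\<rfloor>"
    have L: "?L \<ge> 1" using n by simp
    obtain i j where ij: "i \<in> {1..int ?L}"
      "c0 / (real ?L)\<^sup>2 \<le> measure_pmf.prob (env_pmf p (rectangle ?L n)) {\<omega>. cross_at ?L n i j \<omega>}"
      using ex_likely_crossing[OF n L cross] by blast
    interpret P: prob_space "lorentz_plane p"
      unfolding lorentz_plane_def by (intro prob_space_PiM measure_pmf.prob_space_axioms)
    \<comment> \<open>The crossing hypothesis bounds \<open>c0\<close> by a probability; this gives
      \<open>K \<le> 1\<close> and hence \<open>q \<le> 1\<close>.\<close>
    have "c0 \<le> 1" using cross P.prob_le_1 order_trans by blast
    then have "\<kappa> * c0 \<le> 1 * 1" using \<kappa> c0 by (intro mult_mono) auto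
    then have K1: "K \<le> 1"
      unfolding K_def using \<kappa> c0 by (intro power_le_one) auto
    have q: "0 \<le> q" "q \<le> 1"
    proof -
      have "1 \<le> real n ^ 8" using n by (intro one_le_power) simp
      then have "K \<le> real n ^ 8" using K1 by linarith
      then show "0 \<le> q" "q \<le> 1" using K n by (simp_all add: q_def field_simps)
    qed
    have "q = (\<kappa> * (c0 / (real ?L)\<^sup>2) / (6 * real (?L * n)))\<^sup>2"
      using n by (simp add: q_def K_def field_simps eval_nat_numeral)
    then have dec: "q \<le> measure_pmf.prob (env_pmf p (block n w (w + int ?L)))
        {g. passing n (w + int ?L) (glue (block n 0 w) f g) \<subset> passing n w f}"
      if "0 \<le> w" "passing n w f \<noteq> {}" for w f
      using prob_passing_decreases[OF n _ _ that \<kappa>(1,3) ij(1) _ ij(2)] assms(2,3) c0 by simp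
    have M0: "0 \<le> M" using M C by (meson mult_nonneg_nonneg order_trans less_imp_le of_nat_0_le_iff zero_le_power)
    have "real N \<le> M / (100 * real n)"
      unfolding N_def using M0 by simp
    then have NL: "real (N * ?L) \<le> M" using n by (simp add: field_simps)
    have decay: "(1 - q / 2) ^ N * 4 ^ n \<le> exp (- M / (C * real n ^ 10))"
      unfolding q_def N_def C_def by (rule power_decay_le_exp[OF K K1 n M[unfolded C_def]])
    have "2 * exp (- M / (C * real n ^ 10)) \<le> C * exp (- M / (C * real n ^ 10))"
      using C(2) by (rule mult_right_mono) simp
    then have "1 - C * exp (- M / (C * real n ^ 10)) \<le> 1 - 2 * ((1 - q / 2) ^ N * 4 ^ n)"
      using decay by linarith
    also have "\<dots> \<le> \<P>(\<omega> in lorentz_cylinder n p. localized n M \<omega>)"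
      using assms(2,3) by (intro prob_localized_ge[OF n _ _ NL q dec]) auto
    finally show ?thesis .
  qed
  show ?thesis
    by (intro exI[of _ C] exI[of _ 0] conjI allI impI C(1)) (rule main)
qed

end
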